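(* Let $F$ be a Finsler metric on a manifold $M$ of dimension $n>2$. If $F$ is a $\widetilde W$ metric (that is, $\widetilde W^i{}_k=0$), then $F$ is a $GB\widetilde W$ metric.
   Context: Finsler metric: a nonnegative function $F$ on $TM$, smooth on $TM_0=TM\setminus\{0\}$, with $F(\lambda y)=\lambda F(y)$ for $\lambda>0$, such that $g_{ij}(x,y)=\frac12\frac{\partial^2F^2}{\partial y^i\partial y^j}$ is positive definite on $TM_0$; $(g^{ij})$ is the inverse matrix. Einstein summation is used. All tensors are tensor fields along $TM_0$ (their components are functions of $(x,y)$, $y\neq0$). Spray coefficients: $G^i=\frac14 g^{il}\left\{\frac{\partial^2F^2}{\partial x^k\partial y^l}y^k-\frac{\partial F^2}{\partial x^l}\right\}$; $G^i_j=\frac{\partial G^i}{\partial y^j}$, $G^i_{jk}=\frac{\partial^2G^i}{\partial y^j\partial y^k}$. Horizontal covariant derivative of the Berwald connection, denoted $\mid$: with $\frac{\delta}{\delta x^m}=\frac{\partial}{\partial x^m}-G^r_m\frac{\partial}{\partial y^r}$, $T_j{}^i{}_{\mid m}=\frac{\delta T_j{}^i}{\delta x^m}+T_j{}^rG^i_{rm}-T_r{}^iG^r_{jm}$, and analogously for tensors with more indices. Berwald curvature: $B_j{}^i{}_{kl}=\frac{\partial^3G^i}{\partial y^j\partial y^k\partial y^l}$. $GB\widetilde W$ metric: $B_j{}^i{}_{kl}=\beta_j{}^i{}_{kl}+b_{jkl}y^i$ for some tensors $b_{jkl}$ and $\beta_j{}^i{}_{kl}$ with $\beta_j{}^i{}_{kl\mid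 m}y^m=0$. Riemann curvature: $K^i{}_k=2\frac{\partial G^i}{\partial x^k}-y^j\frac{\partial^2G^i}{\partial x^j\partial y^k}+2G^j\frac{\partial^2G^i}{\partial y^j\partial y^k}-\frac{\partial G^i}{\partial y^j}\frac{\partial G^j}{\partial y^k}$, $K_j{}^i{}_{kl}=\frac13\frac{\partial}{\partial y^j}\left(\frac{\partial K^i{}_k}{\partial y^l}-\frac{\partial K^i{}_l}{\partial y^k}\right)$ (so that $K^i{}_k=K_j{}^i{}_{kl}y^jy^l$), and $K_{jk}=K_j{}^m{}_{mk}$. $\widetilde W$-curvature (C-projective Weyl curvature): $$\widetilde W^i{}_k=K^i{}_k-\frac{1}{1-n^2}\left\{y^i\widetilde K_{0k}-\delta^i_k\widetilde K_{00}\right\},\qquad \widetilde K_{jk}=nK_{jk}+K_{kj}+y^r\frac{\partial K_{kr}}{\partial y^j},$$ where an index $0$ denotes contraction with $y$: $\widetilde K_{0k}=\widetilde K_{jk}y^j$, $\widetilde K_{00}=\widetilde K_{jk}y^jy^k$. $F$ is a $\widetilde W$ metric if $\widetilde W^i{}_k=0$. *)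

theory Defs
  imports "HOL-Analysis.Analysis"
begin

section \<open>Smooth functions and smooth manifolds\<close>

text \<open>On an open set, \<open>C_diff_on k S f\<close> says that \<open>f\<close> is of class \<open>C\<^sup>k\<close>:
  it is (Frechet) differentiable and all its directional derivatives are of class \<open>C\<^sup>k\<^sup>-\<^sup>1\<close>.\<close>

fun C_diff_on :: "nat \<Rightarrow> 'a::real_normed_vector set \<Rightarrow> ('a \<Rightarrow> 'b::real_normed_vector) \<Rightarrow> bool" where
  "C_diff_on 0 S f \<longleftrightarrow> continuous_on S f"
| "C_diff_on (Suc k) S f \<longleftrightarrow>
     (\<forall>x\<in>S. f differentiable (at x)) \<and>
     (\<forall>v. C_diff_on k S (\<lambda>x. frechet_derivative f (at x) v))"

definition smooth_on :: "'a::real_normed_vector set \<Rightarrow> ('a \<Rightarrow> 'b::real_normed_vector) \<Rightarrow> bool" where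
  "smooth_on S f \<longleftrightarrow> (\<forall>k. C_diff_on k S f)"

text \<open>A chart is a pair of its domain and its coordinate map. The underlying space of the
  manifold is the whole (Hausdorff, second countable) type \<open>'m\<close>; its dimension is \<open>CARD('n)\<close>.\<close>

type_synonym ('m, 'n) chart = "'m set \<times> ('m \<Rightarrow> real ^ 'n)"

definition is_chart :: "('m::topological_space, 'n::finite) chart \<Rightarrow> bool" where
  "is_chart c \<longleftrightarrow> open (fst c) \<and> open (snd c ` fst c) \<and>
     (\<exists>\<psi>. homeomorphism (fst c) (snd c ` fst c) (snd c) \<psi>)"

definition transition :: "('m, 'n::finite) chart \<Rightarrow> ('m, 'n) chart \<Rightarrow> real ^ 'n \<Rightarrow> real ^ 'n" where
  "transition c d = snd d \<circ> inv_into (fst c) (snd c)"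

definition overlap :: "('m, 'n::finite) chart \<Rightarrow> ('m, 'n) chart \<Rightarrow> (real ^ 'n) set" where
  "overlap c d = snd c ` (fst c \<inter> fst d)"

definition smooth_atlas ::
    "('m::{t2_space, second_countable_topology}, 'n::finite) chart set \<Rightarrow> bool" where
  "smooth_atlas A \<longleftrightarrow>
     (\<forall>c\<in>A. is_chart c) \<and> (\<Union>c\<in>A. fst c) = UNIV \<and>
     (\<forall>c\<in>A. \<forall>d\<in>A. smooth_on (overlap c d) (transition c d))"


section \<open>The tangent bundle and tensor fields along the slit tangent bundle\<close>

text \<open>The tangent bundle is the union of the sets \<open>snd c ` fst c \<times> \<real>\<^sup>n\<close> over the charts \<open>c\<close>, glued
  along the maps \<open>tangent_transition c d\<close>. Accordingly, a function on it is given by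
  its coordinate expressions, one for every chart, that agree under these maps, and a tensor field
  by its components in every chart, subject to the classical transformation law.
  A point of the tangent bundle is written in coordinates as a pair \<open>(x, y)\<close>.\<close>

type_synonym 'n tpoint = "(real ^ 'n) \<times> (real ^ 'n)"

definition tangent_domain :: "('m, 'n::finite) chart \<Rightarrow> 'n tpoint set" where
  "tangent_domain c = (snd c ` fst c) \<times> UNIV"

definition slit_domain :: "('m, 'n::finite) chart \<Rightarrow> 'n tpoint set" where
  "slit_domain c = (snd c ` fst c) \<times> (- {0})"

definition tangent_transition ::
    "('m, 'n::finite) chart \<Rightarrow> ('m, 'n) chart \<Rightarrow> 'n tpoint \<Rightarrow> 'n tpoint" where
  "tangent_transition c d p =
     (transition c d (fst p), frechet_derivative (transition c d) (at (fst p)) (snd p))"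

text \<open>\<open>jac c d i j x\<close> is the partial derivative, at the point with \<open>c\<close>-coordinates \<open>x\<close>, of the
  \<open>i\<close>-th \<open>d\<close>-coordinate by the \<open>j\<close>-th \<open>c\<close>-coordinate.\<close>

definition jac :: "('m, 'n::finite) chart \<Rightarrow> ('m, 'n) chart \<Rightarrow> 'n \<Rightarrow> 'n \<Rightarrow> real ^ 'n \<Rightarrow> real" where
  "jac c d i j x = frechet_derivative (transition c d) (at x) (axis j 1) $ i"

definition tangent_function ::
    "('m, 'n::finite) chart set \<Rightarrow> (('m, 'n) chart \<Rightarrow> 'n tpoint \<Rightarrow> real) \<Rightarrow> bool" where
  "tangent_function A F \<longleftrightarrow>
     (\<forall>c\<in>A. \<forall>d\<in>A. \<forall>x\<in>overlap c d. \<forall>y. F c (x, y) = F d (tangent_transition c d (x, y)))"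

text \<open>Index order: \<open>T c j k l\<close> stands for the component \<open>T\<^bsub>jkl\<^esub>\<close> in the chart \<open>c\<close>, and
  \<open>T c j i k l\<close> for the one of a tensor with lower indices \<open>j, k, l\<close> and the upper index \<open>i\<close>.\<close>

definition tensor_0_3 ::
    "('m, 'n::finite) chart set \<Rightarrow> (('m, 'n) chart \<Rightarrow> 'n \<Rightarrow> 'n \<Rightarrow> 'n \<Rightarrow> 'n tpoint \<Rightarrow> real) \<Rightarrow> bool" where
  "tensor_0_3 A T \<longleftrightarrow>
     (\<forall>c\<in>A. \<forall>j k l. smooth_on (slit_domain c) (T c j k l)) \<and>
     (\<forall>c\<in>A. \<forall>d\<in>A. \<forall>x\<in>overlap c d. \<forall>y. y \<noteq> 0 \<longrightarrow> (\<forall>j k l.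
        T c j k l (x, y) =
          (\<Sum>q\<in>UNIV. \<Sum>r\<in>UNIV. \<Sum>s\<in>UNIV.
             jac c d q j x * jac c d r k x * jac c d s l x
             * T d q r s (tangent_transition c d (x, y)))))"

definition tensor_1_3 ::
    "('m, 'n::finite) chart set \<Rightarrow>
     (('m, 'n) chart \<Rightarrow> 'n \<Rightarrow> 'n \<Rightarrow> 'n \<Rightarrow> 'n \<Rightarrow> 'n tpoint \<Rightarrow> real) \<Rightarrow> bool" where
  "tensor_1_3 A T \<longleftrightarrow>
     (\<forall>c\<in>A. \<forall>j i k l. smooth_on (slit_domain c) (T c j i k l)) \<and>
     (\<forall>c\<in>A. \<forall>d\<in>A. \<forall>x\<in>overlap c d. \<forall>y. y \<noteq> 0 \<longrightarrow> (\<forall>j i k l.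
        T c j i k l (x, y) =
          (\<Sum>p\<in>UNIV. \<Sum>q\<in>UNIV. \<Sum>r\<in>UNIV. \<Sum>s\<in>UNIV.
             jac d c i p (transition c d x) * jac c d q j x * jac c d r k x * jac c d s l x
             * T d q p r s (tangent_transition c d (x, y)))))"


section \<open>Local expressions of the objects of Finsler geometry\<close>

text \<open>Below, \<open>f\<close> is the coordinate expression of the metric in some chart.\<close>

definition dx :: "'n::finite \<Rightarrow> ('n tpoint \<Rightarrow> real) \<Rightarrow> 'n tpoint \<Rightarrow> real" where
  "dx m f p = frechet_derivative f (at p) (axis m 1, 0)"

definition dy :: "'n::finite \<Rightarrow> ('n tpoint \<Rightarrow> real) \<Rightarrow> 'n tpoint \<Rightarrow> real" where
  "dy m f p = frechet_derivative f (at p) (0, axis m 1)"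

definition fund_tensor :: "('n::finite tpoint \<Rightarrow> real) \<Rightarrow> 'n tpoint \<Rightarrow> real ^ 'n ^ 'n" where
  "fund_tensor f p = (\<chi> i j. 1/2 * dy i (dy j (\<lambda>q. (f q)\<^sup>2)) p)"

definition spray_coeff :: "('n::finite tpoint \<Rightarrow> real) \<Rightarrow> 'n \<Rightarrow> 'n tpoint \<Rightarrow> real" where
  "spray_coeff f i p =
     1/4 * (\<Sum>l\<in>UNIV. matrix_inv (fund_tensor f p) $ i $ l *
       ((\<Sum>k\<in>UNIV. dx k (dy l (\<lambda>q. (f q)\<^sup>2)) p * snd p $ k) - dx l (\<lambda>q. (f q)\<^sup>2) p))"

definition spray_coeff1 :: "('n::finite tpoint \<Rightarrow> real) \<Rightarrow> 'n \<Rightarrow> 'n \<Rightarrow> 'n tpoint \<Rightarrow> real" where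
  "spray_coeff1 f i j = dy j (spray_coeff f i)"

definition spray_coeff2 :: "('n::finite tpoint \<Rightarrow> real) \<Rightarrow> 'n \<Rightarrow> 'n \<Rightarrow> 'n \<Rightarrow> 'n tpoint \<Rightarrow> real" where
  "spray_coeff2 f i j k = dy j (dy k (spray_coeff f i))"

definition berwald_curv ::
    "('n::finite tpoint \<Rightarrow> real) \<Rightarrow> 'n \<Rightarrow> 'n \<Rightarrow> 'n \<Rightarrow> 'n \<Rightarrow> 'n tpoint \<Rightarrow> real" where
  "berwald_curv f j i k l = dy j (dy k (dy l (spray_coeff f i)))"

definition hderiv ::
    "('n::finite tpoint \<Rightarrow> real) \<Rightarrow> 'n \<Rightarrow> ('n tpoint \<Rightarrow> real) \<Rightarrow> 'n tpoint \<Rightarrow> real" where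
  "hderiv f m h p = dx m h p - (\<Sum>r\<in>UNIV. spray_coeff1 f r m p * dy r h p)"

text \<open>Horizontal covariant derivative, for the Berwald connection, of a tensor with components
  \<open>T j i k l\<close> (upper index \<open>i\<close>).\<close>

definition hcov_1_3 ::
    "('n::finite tpoint \<Rightarrow> real) \<Rightarrow> ('n \<Rightarrow> 'n \<Rightarrow> 'n \<Rightarrow> 'n \<Rightarrow> 'n tpoint \<Rightarrow> real) \<Rightarrow>
     'n \<Rightarrow> 'n \<Rightarrow> 'n \<Rightarrow> 'n \<Rightarrow> 'n \<Rightarrow> 'n tpoint \<Rightarrow> real" where
  "hcov_1_3 f T j i k l m p =
     hderiv f m (T j i k l) p
     + (\<Sum>r\<in>UNIV. T j r k l p * spray_coeff2 f i r m p)
     - (\<Sum>r\<in>UNIV. T r i k l p * spray_coeff2 f r j m p)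
     - (\<Sum>r\<in>UNIV. T j i r l p * spray_coeff2 f r k m p)
     - (\<Sum>r\<in>UNIV. T j i k r p * spray_coeff2 f r l m p)"

text \<open>\<open>riem2 f i k\<close> is \<open>K\<^sup>i\<^sub>k\<close>; \<open>riem4 f j i k l\<close> is the tensor with upper index \<open>i\<close>.\<close>

definition riem2 :: "('n::finite tpoint \<Rightarrow> real) \<Rightarrow> 'n \<Rightarrow> 'n \<Rightarrow> 'n tpoint \<Rightarrow> real" where
  "riem2 f i k p =
     2 * dx k (spray_coeff f i) p
     - (\<Sum>j\<in>UNIV. snd p $ j * dx j (dy k (spray_coeff f i)) p)
     + 2 * (\<Sum>j\<in>UNIV. spray_coeff f j p * dy j (dy k (spray_coeff f i)) p)
     - (\<Sum>j\<in>UNIV. dy j (spray_coeff f i) p * dy k (spray_coeff f j) p)"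

definition riem4 ::
    "('n::finite tpoint \<Rightarrow> real) \<Rightarrow> 'n \<Rightarrow> 'n \<Rightarrow> 'n \<Rightarrow> 'n \<Rightarrow> 'n tpoint \<Rightarrow> real" where
  "riem4 f j i k l p = 1/3 * dy j (\<lambda>q. dy l (riem2 f i k) q - dy k (riem2 f i l) q) p"

definition ricci :: "('n::finite tpoint \<Rightarrow> real) \<Rightarrow> 'n \<Rightarrow> 'n \<Rightarrow> 'n tpoint \<Rightarrow> real" where
  "ricci f j k p = (\<Sum>m\<in>UNIV. riem4 f j m m k p)"

definition ricci_tilde :: "('n::finite tpoint \<Rightarrow> real) \<Rightarrow> 'n \<Rightarrow> 'n \<Rightarrow> 'n tpoint \<Rightarrow> real" where
  "ricci_tilde f j k p =
     real CARD('n) * ricci f j k p + ricci f k j p + (\<Sum>r\<in>UNIV. snd p $ r * dy j (ricci f k r) p)"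

definition W_tilde :: "('n::finite tpoint \<Rightarrow> real) \<Rightarrow> 'n \<Rightarrow> 'n \<Rightarrow> 'n tpoint \<Rightarrow> real" where
  "W_tilde f i k p =
     riem2 f i k p - 1 / (1 - (real CARD('n))\<^sup>2) *
       (snd p $ i * (\<Sum>j\<in>UNIV. ricci_tilde f j k p * snd p $ j)
        - (if i = k then 1 else 0)
          * (\<Sum>j\<in>UNIV. \<Sum>h\<in>UNIV. ricci_tilde f j h p * snd p $ j * snd p $ h))"


section \<open>Classes of Finsler metrics\<close>

definition finsler_metric ::
    "('m, 'n::finite) chart set \<Rightarrow> (('m, 'n) chart \<Rightarrow> 'n tpoint \<Rightarrow> real) \<Rightarrow> bool" where
  "finsler_metric A F \<longleftrightarrow>
     tangent_function A F \<and>
     (\<forall>c\<in>A.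
       (\<forall>p\<in>tangent_domain c. F c p \<ge> 0) \<and>
       smooth_on (slit_domain c) (F c) \<and>
       (\<forall>(x, y)\<in>tangent_domain c. \<forall>a>0. F c (x, a *\<^sub>R y) = a * F c (x, y)) \<and>
       (\<forall>p\<in>slit_domain c. \<forall>v. v \<noteq> 0 \<longrightarrow> v \<bullet> (fund_tensor (F c) p *v v) > 0))"

definition W_tilde_metric ::
    "('m, 'n::finite) chart set \<Rightarrow> (('m, 'n) chart \<Rightarrow> 'n tpoint \<Rightarrow> real) \<Rightarrow> bool" where
  "W_tilde_metric A F \<longleftrightarrow> (\<forall>c\<in>A. \<forall>p\<in>slit_domain c. \<forall>i k. W_tilde (F c) i k p = 0)"

definition GBW_tilde_metric ::
    "('m, 'n::finite) chart set \<Rightarrow> (('m, 'n) chart \<Rightarrow> 'n tpoint \<Rightarrow> real) \<Rightarrow> bool" where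
  "GBW_tilde_metric A F \<longleftrightarrow>
     (\<exists>b \<beta>. tensor_0_3 A b \<and> tensor_1_3 A \<beta> \<and>
       (\<forall>c\<in>A. \<forall>p\<in>slit_domain c. \<forall>j i k l.
          berwald_curv (F c) j i k l p = \<beta> c j i k l p + b c j k l p * snd p $ i \<and>
          (\<Sum>m\<in>UNIV. hcov_1_3 (F c) (\<beta> c) j i k l m p * snd p $ m) = 0))"

end

theory Submission
  imports Defs
begin

text \<open>Write \<open>D\<close> for the covariant derivative along the spray, \<open>D T = T\<^bsub>|m\<^esub> y\<^sup>m\<close>. Symmetrising the
  second \<open>y\<close>-derivatives of the Riemann curvature \<open>K\<^sup>i\<^sub>k\<close> over the three lower indices leaves
  \<open>- 3 D B\<close>, where \<open>B\<close> is the Berwald curvature. Vanishing of \<open>W\<close>-tilde says that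
  \<open>K\<^sup>i\<^sub>k = \<delta>\<^sup>i\<^sub>k R + y\<^sup>i \<tau>\<^sub>k\<close> with \<open>R\<close> and \<open>\<tau>\<close> obtained from the Ricci curvature; computing the Ricci
  curvature of this \<open>K\<close> gives \<open>\<tau>\<^sub>k = - (\<partial>R/\<partial>y\<^sup>k) / 2\<close>. Then all terms of \<open>D B\<close> that contain a Kronecker
  symbol cancel, so that \<open>D B\<close> is a multiple of \<open>y\<^sup>i\<close>. Since \<open>F\<close> and \<open>y\<^sub>s = \<partial>(F\<^sup>2/2)/\<partial>y\<^sup>s\<close> are parallel along
  the spray, the angular part \<open>\<beta> = B - b y\<^sup>i\<close> of \<open>B\<close>, with \<open>b = y\<^sub>s B\<^sup>s / F\<^sup>2\<close>, satisfies \<open>D \<beta> = 0\<close>.\<close>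

section \<open>Calculus of smooth functions\<close>

text \<open>The definition asks for tensors that are smooth off the zero section and compatible over
  all charts, so \<open>b\<close> has to be built canonically. Contraction with y_s does this and
  also forces the right derivative: if D B^i = e y^i, then y_s y^s = F^2 and the parallelism of y_s
  and F give D b = e. As D y^i = 0, the fields B^i and b y^i have the same derivative along the
  spray. The price is that B must be shown to be a tensor although the spray coefficients are not.
  Their transformation law contains the second derivatives of the coordinate change, but evaluated
  at (y, y), and three y-derivatives remove such a term. Homogeneity, smoothness and transformation
  law of the spray coefficients are all read off from the linear system with the y-Hessian of F^2 as
  matrix, not from the formula with the inverse matrix.\<close>

lemma frechet_derivative_cong_open:
  assumes "open S" "p \<in> S" "\<And>q. q \<in> S \<Longrightarrow> f q = g q"
  shows "frechet_derivative f (at p) = frechet_derivative g (at p)"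
proof -
  have "(f has_derivative f') (at p) \<longleftrightarrow> (g has_derivative f') (at p)" for f'
    using assms has_derivative_transform_within_open[of f f' p UNIV S g]
      has_derivative_transform_within_open[of g f' p UNIV S f] by auto
  then show ?thesis
    by (simp add: frechet_derivative_def)
qed

lemma differentiable_cong_open:
  assumes "open S" "p \<in> S" "\<And>q. q \<in> S \<Longrightarrow> f q = g q"
  shows "f differentiable (at p) \<longleftrightarrow> g differentiable (at p)"
  using assms has_derivative_transform_within_open[of f _ p UNIV S g]
      has_derivative_transform_within_open[of g _ p UNIV S f]
  by (auto simp: differentiable_def)

lemma C_diff_on_cong:
  assumes "open S" "\<And>q. q \<in> S \<Longrightarrow> f q = g q"
  shows "C_diff_on k S f \<longleftrightarrow> C_diff_on k S g"
  using assms(2)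
proof (induction k arbitrary: f g)
  case 0
  then show ?case by (simp cong: continuous_on_cong)
next
  case (Suc k)
  have "f differentiable (at x) \<longleftrightarrow> g differentiable (at x)" if "x \<in> S" for x
    using differentiable_cong_open[OF assms(1) that Suc.prems] by simp
  moreover have "C_diff_on k S (\<lambda>x. frechet_derivative f (at x) v) \<longleftrightarrow>
      C_diff_on k S (\<lambda>x. frechet_derivative g (at x) v)" for v
    by (rule Suc.IH) (simp add: frechet_derivative_cong_open[OF assms(1) _ Suc.prems])
  ultimately show ?case by simp
qed

text \<open>The recursive definition asks for regularity of the derivatives only. The product rule
  also involves undifferentiated factors, which must be known to be of the lower class as
  well.\<close>

lemma C_diff_on_Suc_imp: "C_diff_on (Suc k) S f \<Longrightarrow> C_diff_on k S f"
proof (induction k arbitrary: f)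
  case 0
  then show ?case
    by (simp add: continuous_at_imp_continuous_on differentiable_imp_continuous_within)
next
  case (Suc k)
  from Suc.prems have "\<forall>x\<in>S. f differentiable (at x)"
    and "\<And>v. C_diff_on (Suc k) S (\<lambda>x. frechet_derivative f (at x) v)"
    unfolding C_diff_on.simps(2)[of "Suc k"] by blast+
  with Suc.IH show ?case
    unfolding C_diff_on.simps(2)[of k S f] by blast
qed

lemma C_diff_on_const: "C_diff_on k S (\<lambda>x. c)"
  by (induction k arbitrary: c) (auto simp: frechet_derivative_const)

lemma frechet_derivative_eqI: "(f has_derivative f') (at p) \<Longrightarrow> frechet_derivative f (at p) v = f' v"
  by (simp add: frechet_derivative_at[symmetric])

lemma has_derivative_frechet_derivative:
  "f differentiable (at p) \<Longrightarrow> (f has_derivative (\<lambda>v. frechet_derivative f (at p) v)) (at p)"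
  by (simp add: frechet_derivative_works[symmetric])

lemma frechet_derivative_bounded_linear:
  "bounded_linear h \<Longrightarrow> frechet_derivative h (at p) v = h v"
  by (rule frechet_derivative_eqI) (rule bounded_linear_imp_has_derivative)

lemma frechet_derivative_add:
  "f differentiable (at p) \<Longrightarrow> g differentiable (at p) \<Longrightarrow>
   frechet_derivative (\<lambda>q. f q + g q) (at p) v =
     frechet_derivative f (at p) v + frechet_derivative g (at p) v"
  by (rule frechet_derivative_eqI) (intro has_derivative_add has_derivative_frechet_derivative)

lemma frechet_derivative_diff:
  "f differentiable (at p) \<Longrightarrow> g differentiable (at p) \<Longrightarrow>
   frechet_derivative (\<lambda>q. f q - g q) (at p) v =
     frechet_derivative f (at p) v - frechet_derivative g (at p) v"
  by (rule frechet_derivative_eqI) (intro has_derivative_diff has_derivative_frechet_derivative)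

lemma frechet_derivative_mult:
  fixes f g :: "'a::real_normed_vector \<Rightarrow> real"
  shows "f differentiable (at p) \<Longrightarrow> g differentiable (at p) \<Longrightarrow>
   frechet_derivative (\<lambda>q. f q * g q) (at p) v =
     f p * frechet_derivative g (at p) v + frechet_derivative f (at p) v * g p"
  by (rule frechet_derivative_eqI) (intro has_derivative_mult has_derivative_frechet_derivative)

lemma frechet_derivative_sum:
  "(\<And>i. i \<in> I \<Longrightarrow> f i differentiable (at p)) \<Longrightarrow>
   frechet_derivative (\<lambda>q. \<Sum>i\<in>I. f i q) (at p) v = (\<Sum>i\<in>I. frechet_derivative (f i) (at p) v)"
  by (rule frechet_derivative_eqI) (intro has_derivative_sum has_derivative_frechet_derivative)

lemma frechet_derivative_inverse:
  fixes f :: "'a::real_normed_vector \<Rightarrow> real"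
  assumes "f differentiable (at p)" "f p \<noteq> 0"
  shows "frechet_derivative (\<lambda>q. inverse (f q)) (at p) v =
     - (inverse (f p) * frechet_derivative f (at p) v * inverse (f p))"
  using assms
  by (intro frechet_derivative_eqI Deriv.has_derivative_inverse has_derivative_frechet_derivative)

lemma frechet_derivative_bounded_linear_compose:
  assumes "bounded_linear h" "f differentiable (at p)"
  shows "frechet_derivative (\<lambda>q. h (f q)) (at p) v = h (frechet_derivative f (at p) v)"
  by (rule frechet_derivative_eqI,
      rule bounded_linear.has_derivative[OF assms(1) has_derivative_frechet_derivative[OF assms(2)]])

lemma C_diff_on_add:
  assumes "open S" "C_diff_on k S f" "C_diff_on k S g"
  shows "C_diff_on k S (\<lambda>x. f x + g x)"
  using assms(2,3)
proof (induction k arbitrary: f g)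
  case (Suc k)
  have "C_diff_on k S (\<lambda>x. frechet_derivative (\<lambda>x. f x + g x) (at x) v)" for v
    using C_diff_on_cong[OF assms(1), of "\<lambda>x. frechet_derivative (\<lambda>x. f x + g x) (at x) v"
        "\<lambda>x. frechet_derivative f (at x) v + frechet_derivative g (at x) v" k] Suc.prems
      Suc.IH[of "\<lambda>x. frechet_derivative f (at x) v" "\<lambda>x. frechet_derivative g (at x) v"]
    by (simp add: frechet_derivative_add)
  with Suc.prems show ?case by simp
qed (simp add: continuous_on_add)

lemma C_diff_on_mult:
  fixes f g :: "'a::real_normed_vector \<Rightarrow> real"
  assumes "open S" "C_diff_on k S f" "C_diff_on k S g"
  shows "C_diff_on k S (\<lambda>x. f x * g x)"
  using assms(2,3)
proof (induction k arbitrary: f g)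
  case (Suc k)
  have "C_diff_on k S (\<lambda>x. f x * frechet_derivative g (at x) v + frechet_derivative f (at x) v * g x)" for v
    using Suc.IH[OF C_diff_on_Suc_imp[OF Suc.prems(1)], of "\<lambda>x. frechet_derivative g (at x) v"]
      Suc.IH[OF _ C_diff_on_Suc_imp[OF Suc.prems(2)], of "\<lambda>x. frechet_derivative f (at x) v"] Suc.prems
    by (intro C_diff_on_add[OF assms(1)]) simp_all
  then have "C_diff_on k S (\<lambda>x. frechet_derivative (\<lambda>x. f x * g x) (at x) v)" for v
    using C_diff_on_cong[OF assms(1), of "\<lambda>x. frechet_derivative (\<lambda>x. f x * g x) (at x) v"
        "\<lambda>x. f x * frechet_derivative g (at x) v + frechet_derivative f (at x) v * g x" k] Suc.prems
    by (simp add: frechet_derivative_mult)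
  with Suc.prems show ?case by simp
qed (simp add: continuous_on_mult)

text \<open>The derivative of 1/f is a product of 1/f, 1/f and a derivative of f, so induction on
  \<open>k\<close> with \<open>f\<close> fixed closes up.\<close>

lemma C_diff_on_inverse:
  fixes f :: "'a::real_normed_vector \<Rightarrow> real"
  assumes "open S" "C_diff_on k S f" "\<And>x. x \<in> S \<Longrightarrow> f x \<noteq> 0"
  shows "C_diff_on k S (\<lambda>x. inverse (f x))"
  using assms(2)
proof (induction k)
  case (Suc k)
  then have inv: "C_diff_on k S (\<lambda>x. inverse (f x))"
    using C_diff_on_Suc_imp by blast
  have "C_diff_on k S (\<lambda>x. frechet_derivative f (at x) v)" for v
    using Suc.prems by simp
  with inv have "C_diff_on k S (\<lambda>x. (-1) * (inverse (f x) * frechet_derivative f (at x) v * inverse (f x)))" for v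
    by (intro C_diff_on_mult[OF assms(1)] C_diff_on_const)
  then have "C_diff_on k S (\<lambda>x. frechet_derivative (\<lambda>x. inverse (f x)) (at x) v)" for v
    using C_diff_on_cong[OF assms(1), of "\<lambda>x. frechet_derivative (\<lambda>x. inverse (f x)) (at x) v"
        "\<lambda>x. (-1) * (inverse (f x) * frechet_derivative f (at x) v * inverse (f x))" k] Suc.prems assms(3)
    by (simp add: frechet_derivative_inverse)
  moreover have "(\<lambda>x. inverse (f x)) differentiable (at x)" if "x \<in> S" for x
    using Suc.prems assms(3)[OF that] that by (simp add: differentiable_inverse)
  ultimately show ?case by simp
qed (use assms(3) in \<open>simp add: continuous_on_inverse\<close>)

lemma C_diff_on_bounded_linear:
  assumes "open S" "bounded_linear h" "C_diff_on k S f"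
  shows "C_diff_on k S (\<lambda>x. h (f x))"
  using assms(3)
proof (induction k arbitrary: f)
  case (Suc k)
  have "C_diff_on k S (\<lambda>x. frechet_derivative (\<lambda>x. h (f x)) (at x) v)" for v
    using C_diff_on_cong[OF assms(1), of "\<lambda>x. frechet_derivative (\<lambda>x. h (f x)) (at x) v"
        "\<lambda>x. h (frechet_derivative f (at x) v)" k]
      Suc.IH[of "\<lambda>x. frechet_derivative f (at x) v"] Suc.prems assms(2)
    by (simp add: frechet_derivative_bounded_linear_compose)
  moreover have "(\<lambda>x. h (f x)) differentiable (at x)" if "x \<in> S" for x
  proof -
    have "f differentiable (at x)" using Suc.prems that by simp
    then show ?thesis
      unfolding differentiable_def using bounded_linear.has_derivative[OF assms(2)] by blast
  qed
  ultimately show ?case by simp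
qed (use assms(2) in \<open>simp add: bounded_linear.continuous_on\<close>)

section \<open>Closure properties of smooth functions\<close>

lemma smooth_on_cong:
  "open S \<Longrightarrow> (\<And>q. q \<in> S \<Longrightarrow> f q = g q) \<Longrightarrow> smooth_on S f \<longleftrightarrow> smooth_on S g"
  by (simp add: smooth_on_def C_diff_on_cong[of S f g])

lemma smooth_on_differentiable: "smooth_on S f \<Longrightarrow> p \<in> S \<Longrightarrow> f differentiable (at p)"
  unfolding smooth_on_def by (drule spec[of _ "Suc 0"]) simp

lemma smooth_on_frechet_derivative:
  assumes "smooth_on S f" shows "smooth_on S (\<lambda>x. frechet_derivative f (at x) v)"
  unfolding smooth_on_def
proof
  fix k
  have "C_diff_on (Suc k) S f" using spec[OF assms[unfolded smooth_on_def], of "Suc k"] .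
  then show "C_diff_on k S (\<lambda>x. frechet_derivative f (at x) v)"
    unfolding C_diff_on.simps by blast
qed

lemma smooth_on_continuous_on: "smooth_on S f \<Longrightarrow> continuous_on S f"
  unfolding smooth_on_def by (drule spec[of _ 0]) simp

lemma smooth_on_const: "smooth_on S (\<lambda>x. c)"
  by (simp add: smooth_on_def C_diff_on_const)

lemma smooth_on_add:
  "open S \<Longrightarrow> smooth_on S f \<Longrightarrow> smooth_on S g \<Longrightarrow> smooth_on S (\<lambda>x. f x + g x)"
  by (simp add: smooth_on_def C_diff_on_add)

lemma smooth_on_mult:
  fixes f g :: "'a::real_normed_vector \<Rightarrow> real"
  shows "open S \<Longrightarrow> smooth_on S f \<Longrightarrow> smooth_on S g \<Longrightarrow> smooth_on S (\<lambda>x. f x * g x)"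
  by (simp add: smooth_on_def C_diff_on_mult)

lemma smooth_on_inverse:
  fixes f :: "'a::real_normed_vector \<Rightarrow> real"
  shows "open S \<Longrightarrow> smooth_on S f \<Longrightarrow> (\<And>x. x \<in> S \<Longrightarrow> f x \<noteq> 0) \<Longrightarrow> smooth_on S (\<lambda>x. inverse (f x))"
  by (simp add: smooth_on_def C_diff_on_inverse)

lemma smooth_on_bounded_linear:
  "open S \<Longrightarrow> bounded_linear h \<Longrightarrow> smooth_on S f \<Longrightarrow> smooth_on S (\<lambda>x. h (f x))"
  by (simp add: smooth_on_def C_diff_on_bounded_linear)

lemma smooth_on_linear:
  assumes "open S" "bounded_linear h" shows "smooth_on S h"
proof -
  have "C_diff_on k S h" for k
  proof (cases k)
    case 0
    then show ?thesis using assms(2) by (simp add: linear_continuous_on)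
  next
    case (Suc l)
    then show ?thesis using assms(2)
      by (simp add: frechet_derivative_bounded_linear C_diff_on_const bounded_linear_imp_differentiable)
  qed
  then show ?thesis by (simp add: smooth_on_def)
qed

lemma smooth_on_diff:
  fixes f g :: "'a::real_normed_vector \<Rightarrow> real"
  assumes "open S" "smooth_on S f" "smooth_on S g"
  shows "smooth_on S (\<lambda>x. f x - g x)"
  using smooth_on_add[OF assms(1,2) smooth_on_mult[OF assms(1) smooth_on_const[of S "-1"] assms(3)]] by simp

lemma smooth_on_divide:
  fixes f g :: "'a::real_normed_vector \<Rightarrow> real"
  assumes "open S" "smooth_on S f" "smooth_on S g" "\<And>x. x \<in> S \<Longrightarrow> g x \<noteq> 0"
  shows "smooth_on S (\<lambda>x. f x / g x)"
  using smooth_on_mult[OF assms(1,2) smooth_on_inverse[OF assms(1,3,4)]] by (simp add: divide_inverse)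

lemma smooth_on_sum:
  "open S \<Longrightarrow> (\<And>i. i \<in> I \<Longrightarrow> smooth_on S (f i)) \<Longrightarrow> smooth_on S (\<lambda>x. \<Sum>i\<in>I. f i x)"
  by (induction I rule: infinite_finite_induct) (auto simp: smooth_on_const smooth_on_add)

lemma smooth_on_prod:
  fixes f :: "'i \<Rightarrow> 'a::real_normed_vector \<Rightarrow> real"
  shows "open S \<Longrightarrow> (\<And>i. i \<in> I \<Longrightarrow> smooth_on S (f i)) \<Longrightarrow> smooth_on S (\<lambda>x. \<Prod>i\<in>I. f i x)"
  by (induction I rule: infinite_finite_induct) (auto simp: smooth_on_const smooth_on_mult)

text \<open>By the Leibniz formula a determinant is polynomial in the entries. Together with
  Cramer's rule this makes solutions of smooth linear systems smooth.\<close>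

lemma smooth_on_det:
  fixes M :: "'a::real_normed_vector \<Rightarrow> real ^ 'n ^ 'n"
  assumes "open S" "\<And>i j. smooth_on S (\<lambda>x. M x $ i $ j)"
  shows "smooth_on S (\<lambda>x. det (M x))"
  unfolding det_def by (intro smooth_on_sum smooth_on_mult smooth_on_prod smooth_on_const assms)

text \<open>The mean value theorem applied twice to the second difference over the parallelogram
  spanned by \<open>h v\<close> and \<open>h w\<close>: once in direction \<open>v\<close>, then in
  direction \<open>w\<close> to the derivative in direction \<open>v\<close>.\<close>

lemma second_difference_mvt:
  fixes f :: "'a::real_normed_vector \<Rightarrow> real"
  assumes f: "\<And>q. q \<in> S \<Longrightarrow> f differentiable (at q)"
    and df: "\<And>q. q \<in> S \<Longrightarrow> (\<lambda>q. frechet_derivative f (at q) v) differentiable (at q)"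
    and h: "0 < h" and S: "\<And>s t. 0 \<le> s \<Longrightarrow> s \<le> h \<Longrightarrow> 0 \<le> t \<Longrightarrow> t \<le> h \<Longrightarrow> p + s *\<^sub>R v + t *\<^sub>R w \<in> S"
  obtains s t where "0 \<le> s" "s \<le> h" "0 \<le> t" "t \<le> h"
    "f (p + h *\<^sub>R v + h *\<^sub>R w) - f (p + h *\<^sub>R v) - f (p + h *\<^sub>R w) + f p =
     h * h * frechet_derivative (\<lambda>q. frechet_derivative f (at q) v) (at (p + s *\<^sub>R v + t *\<^sub>R w)) w"
proof -
  let ?D = "\<lambda>g q. frechet_derivative g (at q)"
  have line: "((\<lambda>s. g (a + s *\<^sub>R u)) has_derivative (\<lambda>e. e * ?D g (a + s *\<^sub>R u) u)) (at s within X)"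
    if "g differentiable (at (a + s *\<^sub>R u))" for g :: "'a \<Rightarrow> real" and a u s X
  proof -
    have "((\<lambda>s. a + s *\<^sub>R u) has_derivative (\<lambda>e. e *\<^sub>R u)) (at s within X)"
      by (auto intro!: derivative_eq_intros)
    from has_derivative_compose[OF this has_derivative_frechet_derivative[OF that]]
    show ?thesis
      using linear_scale[OF linear_frechet_derivative[OF that]] by simp
  qed
  \<comment> \<open>Difference of \<open>f\<close> across the side \<open>h w\<close>; its increment
    over [0, h] is the second difference.\<close>
  let ?\<phi> = "\<lambda>s. f ((p + h *\<^sub>R w) + s *\<^sub>R v) - f (p + s *\<^sub>R v)"
  have in1: "p + h *\<^sub>R w + s *\<^sub>R v \<in> S" "p + s *\<^sub>R v \<in> S" if "0 \<le> s" "s \<le> h" for s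
    using S[of s h] S[of s 0] that h by (simp_all add: ac_simps)
  have "\<exists>s\<in>{0<..<h}. ?\<phi> h - ?\<phi> 0 = (\<lambda>s e. e * ?D f ((p + h *\<^sub>R w) + s *\<^sub>R v) v - e * ?D f (p + s *\<^sub>R v) v) s (h - 0)"
    using in1 by (intro mvt_simple h has_derivative_diff line f) auto
  then obtain s where s: "0 < s" "s < h"
    and "?\<phi> h - ?\<phi> 0 = h * (?D f ((p + h *\<^sub>R w) + s *\<^sub>R v) v - ?D f (p + s *\<^sub>R v) v)"
    by (auto simp: algebra_simps)
  then have 1: "f (p + h *\<^sub>R v + h *\<^sub>R w) - f (p + h *\<^sub>R v) - f (p + h *\<^sub>R w) + f p =
     h * (?D f ((p + s *\<^sub>R v) + h *\<^sub>R w) v - ?D f (p + s *\<^sub>R v) v)"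
    by (simp add: ac_simps)
  let ?\<psi> = "\<lambda>t. ?D f ((p + s *\<^sub>R v) + t *\<^sub>R w) v"
  have "\<exists>t\<in>{0<..<h}. ?\<psi> h - ?\<psi> 0 =
     (\<lambda>t e. e * ?D (\<lambda>q. ?D f q v) ((p + s *\<^sub>R v) + t *\<^sub>R w) w) t (h - 0)"
    using S s by (intro mvt_simple h line df) auto
  then obtain t where "0 < t" "t < h"
    and "?\<psi> h - ?\<psi> 0 = h * ?D (\<lambda>q. ?D f q v) (p + s *\<^sub>R v + t *\<^sub>R w) w"
    by auto
  with 1 s show ?thesis
    by (intro that[of s t]) auto
qed

text \<open>Schwarz's theorem. The second difference is symmetric in \<open>v\<close> and
  \<open>w\<close>, so both mixed derivatives take a common value at points arbitrarily close to
  \<open>p\<close>, and both are continuous there. With \<open>e\<close> half the supposed gap this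
  is contradictory.\<close>

lemma frechet_derivative_commute:
  fixes f :: "'a::real_normed_vector \<Rightarrow> real"
  assumes S: "open S" and f: "smooth_on S f" and p: "p \<in> S"
  shows "frechet_derivative (\<lambda>q. frechet_derivative f (at q) v) (at p) w =
         frechet_derivative (\<lambda>q. frechet_derivative f (at q) w) (at p) v"
    (is "?A p = ?B p")
proof (rule ccontr)
  assume ne: "?A p \<noteq> ?B p"
  define e where "e = dist (?A p) (?B p) / 2"
  have e: "e > 0" using ne by (simp add: e_def)
  have cont: "continuous (at p) (\<lambda>r. frechet_derivative (\<lambda>q. frechet_derivative f (at q) a) (at r) b)" for a b
    using smooth_on_continuous_on[OF smooth_on_frechet_derivative[OF smooth_on_frechet_derivative[OF f]], of a b]
      continuous_on_eq_continuous_at[OF S] p by blast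
  obtain d1 where d1_pos: "d1 > 0" and d1: "\<And>q. dist q p < d1 \<Longrightarrow> dist (?A q) (?A p) < e"
    using cont[of v w, unfolded continuous_at_eps_delta, rule_format, OF e] by blast
  obtain d2 where d2_pos: "d2 > 0" and d2: "\<And>q. dist q p < d2 \<Longrightarrow> dist (?B q) (?B p) < e"
    using cont[of w v, unfolded continuous_at_eps_delta, rule_format, OF e] by blast
  obtain d3 where d3: "d3 > 0" "ball p d3 \<subseteq> S"
    using S p open_contains_ball by blast
  define d where "d = Min {d1, d2, d3}"
  have d: "d > 0" "d \<le> d1" "d \<le> d2" "d \<le> d3" using d1_pos d2_pos d3 by (auto simp: d_def)
  \<comment> \<open>The summand 1 keeps \<open>N\<close> positive when \<open>v\<close> and
    \<open>w\<close> vanish; \<open>h = d / (2 N)\<close> puts the whole parallelogram within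
    distance \<open>d\<close> of \<open>p\<close>.\<close>
  define N where "N = norm v + norm w + 1"
  have N: "N > 0" by (simp add: N_def add_nonneg_pos)
  define h where "h = d / (2 * N)"
  have h: "h > 0" using d(1) N by (simp add: h_def)
  have hN: "h * N = d / 2" using N by (simp add: h_def)
  have hd: "h * norm v + h * norm w < d"
    using hN h d(1) unfolding N_def distrib_left by simp
  have near: "dist (p + s *\<^sub>R v + t *\<^sub>R w) p < d" if "0 \<le> s" "s \<le> h" "0 \<le> t" "t \<le> h" for s t
  proof -
    have "dist (p + s *\<^sub>R v + t *\<^sub>R w) p = norm (s *\<^sub>R v + t *\<^sub>R w)"
      by (simp add: dist_norm add.assoc)
    also have "\<dots> \<le> s * norm v + t * norm w"
      using norm_triangle_ineq[of "s *\<^sub>R v" "t *\<^sub>R w"] that by simp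
    also have "\<dots> \<le> h * norm v + h * norm w"
      using that by (intro add_mono mult_right_mono) auto
    finally show ?thesis using hd by simp
  qed
  have inS: "p + s *\<^sub>R v + t *\<^sub>R w \<in> S" if "0 \<le> s" "s \<le> h" "0 \<le> t" "t \<le> h" for s t
    using near[OF that] d(4) d3(2) by (auto simp: dist_commute)
  have inS': "p + s *\<^sub>R w + t *\<^sub>R v \<in> S" if "0 \<le> s" "s \<le> h" "0 \<le> t" "t \<le> h" for s t
    using inS[of t s] that by (simp add: ac_simps)
  have df: "\<And>q. q \<in> S \<Longrightarrow> f differentiable (at q)"
    "\<And>q u. q \<in> S \<Longrightarrow> (\<lambda>q. frechet_derivative f (at q) u) differentiable (at q)"
    using smooth_on_differentiable[OF f] smooth_on_differentiable[OF smooth_on_frechet_derivative[OF f]]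
    by auto
  obtain s t where st: "0 \<le> s" "s \<le> h" "0 \<le> t" "t \<le> h"
    and A: "f (p + h *\<^sub>R v + h *\<^sub>R w) - f (p + h *\<^sub>R v) - f (p + h *\<^sub>R w) + f p =
     h * h * ?A (p + s *\<^sub>R v + t *\<^sub>R w)"
    using second_difference_mvt[where f = f and S = S and v = v and w = w and p = p and h = h, OF df(1) df(2) h inS]
    by blast
  obtain s' t' where st': "0 \<le> s'" "s' \<le> h" "0 \<le> t'" "t' \<le> h"
    and B: "f (p + h *\<^sub>R w + h *\<^sub>R v) - f (p + h *\<^sub>R w) - f (p + h *\<^sub>R v) + f p =
     h * h * ?B (p + s' *\<^sub>R w + t' *\<^sub>R v)"
    using second_difference_mvt[where f = f and S = S and v = w and w = v and p = p and h = h, OF df(1) df(2) h inS']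
    by blast
  have swap: "p + a *\<^sub>R w + b *\<^sub>R v = p + b *\<^sub>R v + a *\<^sub>R w" for a b
    by (simp only: ac_simps)
  have "h * h * ?A (p + s *\<^sub>R v + t *\<^sub>R w) = h * h * ?B (p + t' *\<^sub>R v + s' *\<^sub>R w)"
    using A B unfolding swap by linarith
  then have eq: "?A (p + s *\<^sub>R v + t *\<^sub>R w) = ?B (p + t' *\<^sub>R v + s' *\<^sub>R w)"
    using h by simp
  have "dist (?A (p + s *\<^sub>R v + t *\<^sub>R w)) (?A p) < e"
    using near[OF st] d(2) by (intro d1) linarith
  moreover have "dist (?B (p + t' *\<^sub>R v + s' *\<^sub>R w)) (?B p) < e"
    using near[OF st'(3,4,1,2)] d(3) by (intro d2) linarith
  ultimately have "dist (?A p) (?B p) < e + e"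
    unfolding eq using dist_triangle3[of "?A p" "?B p" "?B (p + t' *\<^sub>R v + s' *\<^sub>R w)"]
    by linarith
  then show False by (simp add: e_def)
qed

section \<open>Partial derivatives and homogeneous functions on the tangent bundle\<close>

text \<open>Euler's relation, the infinitesimal form of homogeneity of degree \<open>c\<close> in y.
  In this form homogeneity passes to derivatives by differentiating an identity at one point,
  without comparing rescaled points.\<close>

definition euler_on :: "'n::finite tpoint set \<Rightarrow> real \<Rightarrow> ('n tpoint \<Rightarrow> real) \<Rightarrow> bool" where
  "euler_on U c h \<longleftrightarrow> (\<forall>p\<in>U. (\<Sum>j\<in>UNIV. snd p $ j * dy j h p) = c * h p)"

lemma vec_eq_sum_axis: "v = (\<Sum>m\<in>UNIV. (v $ m) *\<^sub>R axis m (1::real))"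
  by (simp add: vec_eq_iff axis_def if_distrib[of "\<lambda>x. _ * x"] cong: if_cong)

lemma frechet_derivative_eq_sum:
  assumes "h differentiable (at p)"
  shows "frechet_derivative h (at p) v =
    (\<Sum>m\<in>UNIV. fst v $ m * dx m h p) + (\<Sum>m\<in>UNIV. snd v $ m * dy m h p)"
proof -
  interpret linear "frechet_derivative h (at p)"
    by (rule linear_frechet_derivative[OF assms])
  have "v = (\<Sum>m\<in>UNIV. (fst v $ m) *\<^sub>R (axis m 1, 0)) + (\<Sum>m\<in>UNIV. (snd v $ m) *\<^sub>R (0, axis m 1))"
    by (rule prod_eqI) (simp_all add: fst_sum snd_sum vec_eq_sum_axis[symmetric])
  then have "frechet_derivative h (at p) v = frechet_derivative h (at p)
      ((\<Sum>m\<in>UNIV. (fst v $ m) *\<^sub>R (axis m 1, 0)) + (\<Sum>m\<in>UNIV. (snd v $ m) *\<^sub>R (0, axis m 1)))"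
    by (rule arg_cong)
  moreover have "frechet_derivative h (at p) (a *\<^sub>R u, 0) = a * frechet_derivative h (at p) (u, 0)"
    "frechet_derivative h (at p) (0, a *\<^sub>R u) = a * frechet_derivative h (at p) (0, u)" for a u
    using scale[of a "(u, 0)"] scale[of a "(0, u)"] by simp_all
  ultimately show ?thesis
    by (simp add: add sum dx_def dy_def)
qed

lemma sum_delta_mult [simp]:
  fixes f :: "'n::finite \<Rightarrow> real"
  shows "(\<Sum>j\<in>UNIV. (if j = k then 1 else 0) * f j) = f k"
    "(\<Sum>j\<in>UNIV. (if k = j then 1 else 0) * f j) = f k"
    "(\<Sum>j\<in>UNIV. f j * (if j = k then 1 else 0)) = f k"
    "(\<Sum>j\<in>UNIV. f j * (if k = j then 1 else 0)) = f k"
  by (simp_all add: if_distrib[of "\<lambda>x. x * _"] if_distrib[of "\<lambda>x. _ * x"] cong: if_cong)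

text \<open>The open set is arbitrary because the calculus is used both over a whole chart and over
  the overlap of two charts.\<close>

locale tangent_open =
  fixes U :: "'n::finite tpoint set"
  assumes open_U: "open U"
begin

abbreviation "sm \<equiv> smooth_on U"

lemma sm_dx [simp]: "sm h \<Longrightarrow> sm (dx m h)"
  unfolding dx_def[abs_def] by (rule smooth_on_frechet_derivative)

lemma sm_dy [simp]: "sm h \<Longrightarrow> sm (dy m h)"
  unfolding dy_def[abs_def] by (rule smooth_on_frechet_derivative)

lemma sm_coord [simp]: "sm (\<lambda>q. snd q $ m)"
  by (rule smooth_on_linear[OF open_U]) (rule bounded_linear_compose[OF bounded_linear_vec_nth bounded_linear_snd])

lemma sm_intros [simp]:
  fixes g h :: "'n tpoint \<Rightarrow> real" and H :: "'i \<Rightarrow> 'n tpoint \<Rightarrow> real"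
  shows
  "sm (\<lambda>q. c)"
  "sm g \<Longrightarrow> sm h \<Longrightarrow> sm (\<lambda>q. g q + h q)"
  "sm g \<Longrightarrow> sm h \<Longrightarrow> sm (\<lambda>q. g q - h q)"
  "sm g \<Longrightarrow> sm h \<Longrightarrow> sm (\<lambda>q. g q * h q)"
  "(\<And>i. i \<in> I \<Longrightarrow> sm (H i)) \<Longrightarrow> sm (\<lambda>q. \<Sum>i\<in>I. H i q)"
  by (intro smooth_on_const smooth_on_add smooth_on_diff smooth_on_mult smooth_on_sum open_U; assumption)+

lemma sm_divide [simp]:
  fixes g h :: "'n tpoint \<Rightarrow> real"
  shows "sm g \<Longrightarrow> sm h \<Longrightarrow> (\<And>q. q \<in> U \<Longrightarrow> h q \<noteq> 0) \<Longrightarrow> sm (\<lambda>q. g q / h q)"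
  by (rule smooth_on_divide[OF open_U])

lemma sm_cong: "(\<And>q. q \<in> U \<Longrightarrow> g q = h q) \<Longrightarrow> sm g \<longleftrightarrow> sm h"
  by (rule smooth_on_cong[OF open_U])

lemma fd_rules:
  fixes g h :: "'n tpoint \<Rightarrow> real" and H :: "'i \<Rightarrow> 'n tpoint \<Rightarrow> real"
  assumes "p \<in> U"
  shows "sm g \<Longrightarrow> sm h \<Longrightarrow> frechet_derivative (\<lambda>q. g q + h q) (at p) v =
      frechet_derivative g (at p) v + frechet_derivative h (at p) v"
    "sm g \<Longrightarrow> sm h \<Longrightarrow> frechet_derivative (\<lambda>q. g q - h q) (at p) v =
      frechet_derivative g (at p) v - frechet_derivative h (at p) v"
    "sm g \<Longrightarrow> sm h \<Longrightarrow> frechet_derivative (\<lambda>q. g q * h q) (at p) v =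
      g p * frechet_derivative h (at p) v + frechet_derivative g (at p) v * h p"
    "(\<And>i. i \<in> I \<Longrightarrow> sm (H i)) \<Longrightarrow> frechet_derivative (\<lambda>q. \<Sum>i\<in>I. H i q) (at p) v =
      (\<Sum>i\<in>I. frechet_derivative (H i) (at p) v)"
  by (intro frechet_derivative_add frechet_derivative_diff frechet_derivative_mult
      frechet_derivative_sum smooth_on_differentiable[OF _ assms]; assumption)+

lemma fd_coord: "frechet_derivative (\<lambda>q::'n tpoint. snd q $ m) (at p) v = snd v $ m"
  by (rule frechet_derivative_bounded_linear)
    (rule bounded_linear_compose[OF bounded_linear_vec_nth bounded_linear_snd])

lemma dx_rules:
  fixes g h :: "'n tpoint \<Rightarrow> real" and H :: "'i \<Rightarrow> 'n tpoint \<Rightarrow> real"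
  assumes "p \<in> U"
  shows "dx m (\<lambda>q. c) p = 0"
    "sm g \<Longrightarrow> sm h \<Longrightarrow> dx m (\<lambda>q. g q + h q) p = dx m g p + dx m h p"
    "sm g \<Longrightarrow> sm h \<Longrightarrow> dx m (\<lambda>q. g q - h q) p = dx m g p - dx m h p"
    "sm g \<Longrightarrow> sm h \<Longrightarrow> dx m (\<lambda>q. g q * h q) p = g p * dx m h p + dx m g p * h p"
    "(\<And>i. i \<in> I \<Longrightarrow> sm (H i)) \<Longrightarrow> dx m (\<lambda>q. \<Sum>i\<in>I. H i q) p = (\<Sum>i\<in>I. dx m (H i) p)"
    "dx m (\<lambda>q. snd q $ k) p = 0"
  using assms by (simp_all add: dx_def fd_rules fd_coord)

lemma dy_rules:
  fixes g h :: "'n tpoint \<Rightarrow> real" and H :: "'i \<Rightarrow> 'n tpoint \<Rightarrow> real"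
  assumes "p \<in> U"
  shows "dy m (\<lambda>q. c) p = 0"
    "sm g \<Longrightarrow> sm h \<Longrightarrow> dy m (\<lambda>q. g q + h q) p = dy m g p + dy m h p"
    "sm g \<Longrightarrow> sm h \<Longrightarrow> dy m (\<lambda>q. g q - h q) p = dy m g p - dy m h p"
    "sm g \<Longrightarrow> sm h \<Longrightarrow> dy m (\<lambda>q. g q * h q) p = g p * dy m h p + dy m g p * h p"
    "(\<And>i. i \<in> I \<Longrightarrow> sm (H i)) \<Longrightarrow> dy m (\<lambda>q. \<Sum>i\<in>I. H i q) p = (\<Sum>i\<in>I. dy m (H i) p)"
    "dy m (\<lambda>q. snd q $ k) p = (if k = m then 1 else 0)"
  using assms by (simp_all add: dy_def fd_rules fd_coord axis_def)

lemma dy_divide: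
  fixes g :: "'n tpoint \<Rightarrow> real"
  assumes "sm g" "p \<in> U"
  shows "dy m (\<lambda>q. g q / c) p = dy m g p / c"
  using dy_rules(4)[of p g "\<lambda>q. inverse c" m] dy_rules(1)[of p m "inverse c"] assms
  by (simp add: divide_inverse)

lemma dx_cong: "(\<And>q. q \<in> U \<Longrightarrow> g q = h q) \<Longrightarrow> p \<in> U \<Longrightarrow> dx m g p = dx m h p"
  unfolding dx_def using frechet_derivative_cong_open[OF open_U, of p g h] by simp

lemma dy_cong: "(\<And>q. q \<in> U \<Longrightarrow> g q = h q) \<Longrightarrow> p \<in> U \<Longrightarrow> dy m g p = dy m h p"
  unfolding dy_def using frechet_derivative_cong_open[OF open_U, of p g h] by simp

lemma dy_dy: "sm h \<Longrightarrow> p \<in> U \<Longrightarrow> dy j (dy k h) p = dy k (dy j h) p"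
  unfolding dy_def[abs_def] by (rule frechet_derivative_commute[OF open_U])

lemma dy_dx: "sm h \<Longrightarrow> p \<in> U \<Longrightarrow> dy j (dx k h) p = dx k (dy j h) p"
  unfolding dy_def[abs_def] dx_def[abs_def] by (rule frechet_derivative_commute[OF open_U])

section \<open>Homogeneity through Euler's relation\<close>

lemma fd_eq_sum:
  "sm h \<Longrightarrow> p \<in> U \<Longrightarrow> frechet_derivative h (at p) v =
    (\<Sum>m\<in>UNIV. fst v $ m * dx m h p) + (\<Sum>m\<in>UNIV. snd v $ m * dy m h p)"
  by (rule frechet_derivative_eq_sum) (rule smooth_on_differentiable)

text \<open>The sum in Euler's relation is a single directional derivative, along (0, y); the
  closure properties below then follow from the rules of differentiation.\<close>

lemma euler_on_iff:
  "sm h \<Longrightarrow> euler_on U c h \<longleftrightarrow> (\<forall>p\<in>U. frechet_derivative h (at p) (0, snd p) = c * h p)"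
  by (simp add: euler_on_def fd_eq_sum)

lemma euler_onD: "euler_on U c h \<Longrightarrow> p \<in> U \<Longrightarrow> (\<Sum>j\<in>UNIV. snd p $ j * dy j h p) = c * h p"
  by (simp add: euler_on_def)

lemma euler_on_fdD:
  "euler_on U c h \<Longrightarrow> sm h \<Longrightarrow> p \<in> U \<Longrightarrow> frechet_derivative h (at p) (0, snd p) = c * h p"
  by (simp add: euler_on_iff)

lemma euler_on_fdI:
  "sm h \<Longrightarrow> (\<And>p. p \<in> U \<Longrightarrow> frechet_derivative h (at p) (0, snd p) = c * h p) \<Longrightarrow> euler_on U c h"
  by (simp add: euler_on_iff)

lemma euler_on_cong: "(\<And>q. q \<in> U \<Longrightarrow> g q = h q) \<Longrightarrow> euler_on U c g \<longleftrightarrow> euler_on U c h"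
  by (simp add: euler_on_def dy_cong[of g h])

lemma euler_on_add: "sm g \<Longrightarrow> sm h \<Longrightarrow> euler_on U c g \<Longrightarrow> euler_on U c h \<Longrightarrow> euler_on U c (\<lambda>q. g q + h q)"
  by (simp add: euler_on_iff fd_rules distrib_left)

lemma euler_on_diff: "sm g \<Longrightarrow> sm h \<Longrightarrow> euler_on U c g \<Longrightarrow> euler_on U c h \<Longrightarrow> euler_on U c (\<lambda>q. g q - h q)"
  by (simp add: euler_on_iff fd_rules right_diff_distrib)

lemma euler_on_mult:
  "sm g \<Longrightarrow> sm h \<Longrightarrow> euler_on U a g \<Longrightarrow> euler_on U b h \<Longrightarrow> c = a + b \<Longrightarrow> euler_on U c (\<lambda>q. g q * h q)"
  by (simp add: euler_on_iff fd_rules algebra_simps)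

lemma euler_on_sum:
  "(\<And>i. i \<in> I \<Longrightarrow> sm (H i)) \<Longrightarrow> (\<And>i. i \<in> I \<Longrightarrow> euler_on U c (H i)) \<Longrightarrow> euler_on U c (\<lambda>q. \<Sum>i\<in>I. H i q)"
  by (simp add: euler_on_iff fd_rules sum_distrib_left)

lemma euler_on_coord: "euler_on U 1 (\<lambda>q. snd q $ k)"
  by (simp add: euler_on_iff fd_coord)

lemma euler_on_const: "euler_on U 0 (\<lambda>q. a)"
  by (simp add: euler_on_iff)

text \<open>Differentiating Euler's relation by y^k also hits the coefficients y^j; this produces
  one extra \<open>dy k h\<close> and lowers the degree. The remaining terms need the symmetry of
  second derivatives.\<close>

lemma euler_on_dy:
  assumes h: "sm h" and e: "euler_on U c h"
  shows "euler_on U (c - 1) (dy k h)"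
  unfolding euler_on_def
proof
  fix p assume p: "p \<in> U"
  have "dy k (\<lambda>q. \<Sum>j\<in>UNIV. snd q $ j * dy j h q) p = dy k (\<lambda>q. c * h q) p"
    using e by (intro dy_cong[OF _ p]) (simp add: euler_on_def)
  then show "(\<Sum>j\<in>UNIV. snd p $ j * dy j (dy k h) p) = (c - 1) * dy k h p"
    using h p by (simp add: dy_rules dy_dy[of h p k] sum.distrib algebra_simps)
qed

lemma euler_on_dx:
  assumes h: "sm h" and e: "euler_on U c h"
  shows "euler_on U c (dx k h)"
  unfolding euler_on_def
proof
  fix p assume p: "p \<in> U"
  have "dx k (\<lambda>q. \<Sum>j\<in>UNIV. snd q $ j * dy j h q) p = dx k (\<lambda>q. c * h q) p"
    using e by (intro dx_cong[OF _ p]) (simp add: euler_on_def)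
  then show "(\<Sum>j\<in>UNIV. snd p $ j * dy j (dx k h) p) = c * dx k h p"
    using h p by (simp add: dx_rules dy_dx)
qed

end

section \<open>The spray of a Finsler metric\<close>

locale finsler_chart =
  fixes V :: "(real ^ 'n::finite) set" and f :: "'n tpoint \<Rightarrow> real"
  assumes open_V: "open V"
    and smooth_f: "smooth_on (V \<times> (- {0})) f"
    and homogeneous: "\<And>x y a. x \<in> V \<Longrightarrow> a > 0 \<Longrightarrow> f (x, a *\<^sub>R y) = a * f (x, y)"
    and positive_definite: "\<And>p v. p \<in> V \<times> (- {0}) \<Longrightarrow> v \<noteq> 0 \<Longrightarrow> v \<bullet> (fund_tensor f p *v v) > 0"
begin

abbreviation U :: "'n tpoint set" where "U \<equiv> V \<times> (- {0})"

sublocale tangent_open U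
  by unfold_locales (intro open_Times open_V open_Compl closed_singleton)

abbreviation L :: "'n tpoint \<Rightarrow> real" where "L \<equiv> \<lambda>q. (f q)\<^sup>2"

abbreviation G :: "'n \<Rightarrow> 'n tpoint \<Rightarrow> real" where "G \<equiv> spray_coeff f"

lemma sm_L [simp]: "sm L"
  using smooth_on_mult[OF open_U smooth_f smooth_f] by (simp add: power2_eq_square)

text \<open>The identity L(x, a y) = a^2 L(x, y) is differentiated at a = 1, once by the chain rule
  and once explicitly. It is available for a > 0, which is a neighbourhood of 1.\<close>

lemma euler_L: "euler_on U 2 L"
  unfolding euler_on_iff[OF sm_L]
proof
  fix p assume p: "p \<in> U"
  have hom: "L (fst p, a *\<^sub>R snd p) = a\<^sup>2 * L p" if "a > 0" for a
    using homogeneous[of "fst p" a "snd p"] p that by (auto simp: power_mult_distrib)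
  have 1: "((\<lambda>a. L (fst p, a *\<^sub>R snd p)) has_derivative (\<lambda>e. frechet_derivative L (at p) (e *\<^sub>R (0, snd p)))) (at 1)"
  proof -
    have "((\<lambda>a. (fst p, a *\<^sub>R snd p)) has_derivative (\<lambda>e. (0, e *\<^sub>R snd p))) (at 1)"
      by (auto intro!: derivative_eq_intros)
    moreover have "(L has_derivative frechet_derivative L (at p)) (at (fst p, 1 *\<^sub>R snd p))"
      using has_derivative_frechet_derivative[OF smooth_on_differentiable[OF sm_L p]] by simp
    ultimately show ?thesis
      using has_derivative_compose by fastforce
  qed
  have "((\<lambda>a. a\<^sup>2 * L p) has_derivative (\<lambda>e. e * (2 * L p))) (at 1)"
    by (auto intro!: derivative_eq_intros)
  then have "((\<lambda>a. L (fst p, a *\<^sub>R snd p)) has_derivative (\<lambda>e. e * (2 * L p))) (at 1)"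
    by (rule has_derivative_transform_within_open[of _ _ _ _ "{0<..}"]) (simp_all add: hom)
  from has_derivative_unique[OF 1 this]
  have "frechet_derivative L (at p) (1 *\<^sub>R (0, snd p)) = 1 * (2 * L p)"
    by (rule fun_cong)
  then show "frechet_derivative L (at p) (0, snd p) = 2 * L p" by simp
qed

text \<open>Euler's relation for \<open>L\<close> and for its first derivatives gives g_ij y^i y^j =
  F^2, so positive definiteness applies. This later permits the division by F^2.\<close>

lemma L_pos: assumes p: "p \<in> U" shows "L p > 0"
proof -
  have "(\<Sum>j\<in>UNIV. snd p $ j * dy j (dy i L) p) = dy i L p" for i
    using euler_onD[OF euler_on_dy[OF sm_L euler_L] p, of i] by simp
  then have "(\<Sum>i\<in>UNIV. snd p $ i * (\<Sum>j\<in>UNIV. snd p $ j * dy j (dy i L) p)) = 2 * L p"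
    using euler_onD[OF euler_L p] by simp
  moreover have "snd p \<bullet> (fund_tensor f p *v snd p) =
      (\<Sum>i\<in>UNIV. snd p $ i * (\<Sum>j\<in>UNIV. 1/2 * (snd p $ j * dy i (dy j L) p)))"
    by (simp add: inner_vec_def matrix_vector_mult_def fund_tensor_def mult.commute)
  ultimately have "snd p \<bullet> (fund_tensor f p *v snd p) = L p"
    using p by (simp add: dy_dy[of L p] sum_divide_distrib[symmetric])
  then show ?thesis
    using positive_definite[OF p, of "snd p"] p by auto
qed

lemma fund_tensor_invertible: "p \<in> U \<Longrightarrow> invertible (fund_tensor f p)"
  unfolding invertible_left_inverse matrix_left_invertible_ker
  using positive_definite by fastforce

text \<open>The spray coefficients are the unique solution of this linear system; no other
  property of their definition is needed.\<close>

lemma spray_equation: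
  assumes p: "p \<in> U"
  shows "2 * (\<Sum>i\<in>UNIV. dy i (dy l L) p * G i p) =
    (\<Sum>k\<in>UNIV. snd p $ k * dx k (dy l L) p) - dx l L p"
proof -
  let ?w = "\<chi> l. (\<Sum>k\<in>UNIV. dx k (dy l L) p * snd p $ k) - dx l L p"
  have "fund_tensor f p ** matrix_inv (fund_tensor f p) = mat 1"
    using fund_tensor_invertible[OF p] unfolding invertible_def matrix_inv_def
    by (rule someI2_ex) blast
  moreover have "(\<chi> i. G i p) = (1/4) *\<^sub>R (matrix_inv (fund_tensor f p) *v ?w)"
    by (simp add: vec_eq_iff spray_coeff_def matrix_vector_mult_def)
  ultimately have "fund_tensor f p *v (\<chi> i. G i p) = (1/4) *\<^sub>R ?w"
    by (simp add: matrix_vector_mul_assoc matrix_vector_mult_scaleR)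
  then have "(fund_tensor f p *v (\<chi> i. G i p)) $ l = ((1/4) *\<^sub>R ?w) $ l"
    by simp
  then show ?thesis
    using p by (simp add: matrix_vector_mult_def fund_tensor_def dy_dy[of L p l] mult.commute
        sum_divide_distrib[symmetric])
qed

text \<open>The matrix is twice the positive definite fundamental tensor. Identities for the spray
  coefficients are obtained by checking that both sides solve the same system.\<close>

lemma spray_unique:
  assumes p: "p \<in> U"
    and eq: "\<And>l. (\<Sum>i\<in>UNIV. dy i (dy l L) p * v i) = (\<Sum>i\<in>UNIV. dy i (dy l L) p * w i)"
  shows "v = w"
proof -
  have "fund_tensor f p *v (\<chi> i. v i - w i) = 0"
    using eq p by (simp add: vec_eq_iff matrix_vector_mult_def fund_tensor_def dy_dy[of L p]
        algebra_simps sum_subtractf sum_divide_distrib[symmetric])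
  then have "(\<chi> i. v i - w i) = 0"
    using positive_definite[OF p, of "\<chi> i. v i - w i"] by fastforce
  then show ?thesis by (simp add: vec_eq_iff fun_eq_iff)
qed

text \<open>Cramer's rule writes the solution of the spray equation as a quotient of determinants
  with smooth entries, so no regularity of \<open>matrix_inv\<close> has to be discussed.\<close>

lemma sm_G [simp]: "sm (G k)"
proof -
  let ?w = "\<lambda>p. (\<chi> l. (\<Sum>k\<in>UNIV. snd p $ k * dx k (dy l L) p) - dx l L p) :: real ^ 'n"
  let ?M = "\<lambda>p. (\<chi> l i. 2 * dy i (dy l L) p) :: real ^ 'n ^ 'n"
  let ?N = "\<lambda>p. (\<chi> i j. if j = k then ?w p $ i else ?M p $ i $ j) :: real ^ 'n ^ 'n"
  \<comment> \<open>The Hessian of F^2 is twice the fundamental tensor, and the spray equation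
    carries another factor 2.\<close>
  have M: "?M p = 4 *\<^sub>R fund_tensor f p" if "p \<in> U" for p
    using that by (simp add: vec_eq_iff fund_tensor_def dy_dy[of L p])
  have nz: "det (?M p) \<noteq> 0" if "p \<in> U" for p
  proof -
    have "invertible (?M p)"
      unfolding M[OF that] invertible_left_inverse matrix_left_invertible_ker
      using positive_definite[OF that] by (fastforce simp: scaleR_matrix_vector_assoc[symmetric])
    then show ?thesis by (simp add: invertible_det_nz)
  qed
  have eq: "G k p = det (?N p) / det (?M p)" if p: "p \<in> U" for p
  proof -
    have "?M p *v (\<chi> i. G i p) = ?w p"
      using spray_equation[OF p] by (simp add: vec_eq_iff matrix_vector_mult_def sum_distrib_left mult.assoc)
    then have "(\<chi> i. G i p) = (\<chi> k. det (\<chi> i j. if j = k then ?w p $ i else ?M p $ i $ j) / det (?M p))"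
      unfolding cramer[OF nz[OF p]] .
    then show ?thesis by (simp add: vec_eq_iff)
  qed
  have "sm (G k) \<longleftrightarrow> sm (\<lambda>p. det (?N p) / det (?M p))"
    by (rule sm_cong) (rule eq)
  also have "\<dots>"
    by (intro sm_divide smooth_on_det[OF open_U] nz) (case_tac "j = k"; simp)+
  finally show ?thesis .
qed

text \<open>The spray equation is differentiated along (0, y). Its matrix has degree 0 and its
  right-hand side degree 2, so the radial derivatives of the spray coefficients and their doubles
  solve the same system.\<close>

lemma euler_G: "euler_on U 2 (G k)"
proof -
  have "(\<lambda>i. frechet_derivative (G i) (at p) (0, snd p)) = (\<lambda>i. 2 * G i p)" if p: "p \<in> U" for p
  proof (rule spray_unique[OF p])
    fix l
    have 1: "euler_on U (2 - 1 - 1) (dy i (dy l L))" for i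
      by (intro euler_on_dy sm_dy sm_L euler_L)
    have 2: "euler_on U 2 (\<lambda>p. (\<Sum>k\<in>UNIV. snd p $ k * dx k (dy l L) p) - dx l L p)"
      by (intro euler_on_diff euler_on_sum euler_on_mult[OF _ _ euler_on_coord euler_on_dx[OF _ euler_on_dy]]
          euler_on_dx euler_L) (simp_all add: euler_L)
    have "euler_on U 2 (\<lambda>p. 2 * (\<Sum>i\<in>UNIV. dy i (dy l L) p * G i p))"
      using 2 by (subst euler_on_cong[OF spray_equation])
    then have "frechet_derivative (\<lambda>p. 2 * (\<Sum>i\<in>UNIV. dy i (dy l L) p * G i p)) (at p) (0, snd p)
        = 2 * (2 * (\<Sum>i\<in>UNIV. dy i (dy l L) p * G i p))"
      by (rule euler_on_fdD[OF _ _ p]) simp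
    moreover have "frechet_derivative (dy i (dy l L)) (at p) (0, snd p) = 0" for i
      using euler_on_fdD[OF 1 _ p, of i] by simp
    ultimately show "(\<Sum>i\<in>UNIV. dy i (dy l L) p * frechet_derivative (G i) (at p) (0, snd p))
        = (\<Sum>i\<in>UNIV. dy i (dy l L) p * (2 * G i p))"
      using p by (simp add: fd_rules sum_distrib_left[of 2, symmetric] mult.left_commute[of _ 2 "G _ p"])
  qed
  then show ?thesis
    by (intro euler_on_fdI) (simp_all add: fun_eq_iff)
qed

section \<open>Differentiation along the spray\<close>

abbreviation K :: "'n \<Rightarrow> 'n \<Rightarrow> 'n tpoint \<Rightarrow> real" where "K \<equiv> riem2 f"

abbreviation B :: "'n \<Rightarrow> 'n \<Rightarrow> 'n \<Rightarrow> 'n \<Rightarrow> 'n tpoint \<Rightarrow> real" where "B \<equiv> berwald_curv f"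

text \<open>Derivative along the spray vector field y^m d/dx^m - 2 G^i d/dy^i. On functions it is
  \<open>hderiv\<close> contracted with y, because G^r_m y^m = 2 G^r.\<close>

definition spray_deriv :: "('n tpoint \<Rightarrow> real) \<Rightarrow> 'n tpoint \<Rightarrow> real" where
  "spray_deriv h p = frechet_derivative h (at p) (snd p, \<chi> i. - 2 * G i p)"

lemma spray_deriv_eq:
  "sm h \<Longrightarrow> p \<in> U \<Longrightarrow> spray_deriv h p =
    (\<Sum>m\<in>UNIV. snd p $ m * dx m h p) - 2 * (\<Sum>r\<in>UNIV. G r p * dy r h p)"
  by (simp add: spray_deriv_def fd_eq_sum sum_negf sum_distrib_left mult.assoc)

lemma spray_deriv_rules:
  assumes "p \<in> U"
  shows "sm g \<Longrightarrow> sm h \<Longrightarrow> spray_deriv (\<lambda>q. g q + h q) p = spray_deriv g p + spray_deriv h p"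
    "sm g \<Longrightarrow> sm h \<Longrightarrow> spray_deriv (\<lambda>q. g q - h q) p = spray_deriv g p - spray_deriv h p"
    "sm g \<Longrightarrow> sm h \<Longrightarrow> spray_deriv (\<lambda>q. g q * h q) p = g p * spray_deriv h p + spray_deriv g p * h p"
    "(\<And>i. i \<in> I \<Longrightarrow> sm (H i)) \<Longrightarrow> spray_deriv (\<lambda>q. \<Sum>i\<in>I. H i q) p = (\<Sum>i\<in>I. spray_deriv (H i) p)"
    "spray_deriv (\<lambda>q. snd q $ k) p = - 2 * G k p"
    "spray_deriv (\<lambda>q. c) p = 0"
  using assms by (simp_all add: spray_deriv_def fd_rules fd_coord)

lemma spray_deriv_cong:
  "(\<And>q. q \<in> U \<Longrightarrow> g q = h q) \<Longrightarrow> p \<in> U \<Longrightarrow> spray_deriv g p = spray_deriv h p"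
  unfolding spray_deriv_def using frechet_derivative_cong_open[OF open_U, of p g h] by simp

lemma euler_G0: "p \<in> U \<Longrightarrow> (\<Sum>j\<in>UNIV. snd p $ j * dy j (G i) p) = 2 * G i p"
  using euler_onD[OF euler_G] by simp

lemma euler_G1: "p \<in> U \<Longrightarrow> (\<Sum>j\<in>UNIV. snd p $ j * dy k (dy j (G i)) p) = dy k (G i) p"
  using euler_onD[OF euler_on_dy[OF sm_G euler_G]] by (simp add: dy_dy[of "G i" p k])

text \<open>The spray equation read as the Euler-Lagrange equation of F^2.\<close>

lemma spray_deriv_L_eq_dx: "p \<in> U \<Longrightarrow> spray_deriv (dy l L) p = dx l L p"
  using spray_equation[of p l] by (simp add: spray_deriv_eq mult.commute)

text \<open>Conservation of energy: applying the spray to Euler's relation y^j dL/dy^j = 2 L and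
  using the Euler-Lagrange equation gives 2 D L = D L.\<close>

lemma spray_deriv_L: assumes p: "p \<in> U" shows "spray_deriv L p = 0"
proof -
  have "spray_deriv (\<lambda>q. \<Sum>j\<in>UNIV. snd q $ j * dy j L q) p = spray_deriv (\<lambda>q. 2 * L q) p"
    by (rule spray_deriv_cong[OF _ p]) (rule euler_onD[OF euler_L])
  then have "2 * spray_deriv L p = (\<Sum>j\<in>UNIV. snd p $ j * dx j L p - 2 * (G j p * dy j L p))"
    using p by (simp add: spray_deriv_rules spray_deriv_L_eq_dx mult.assoc)
  also have "\<dots> = spray_deriv L p"
    using p by (simp add: spray_deriv_eq sum_subtractf sum_distrib_left)
  finally show ?thesis by simp
qed

text \<open>Parallelism of the covector y_l. It arises by differentiating D L = 0 in y^l and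
  inserting the Euler-Lagrange equation.\<close>

lemma spray_deriv_dy_L:
  assumes p: "p \<in> U"
  shows "spray_deriv (dy l L) p = (\<Sum>r\<in>UNIV. dy l (G r) p * dy r L p)"
proof -
  have "dy l (\<lambda>q. (\<Sum>m\<in>UNIV. snd q $ m * dx m L q) - 2 * (\<Sum>r\<in>UNIV. G r q * dy r L q)) p = dy l (\<lambda>q. 0) p"
    using spray_deriv_L by (intro dy_cong[OF _ p]) (simp add: spray_deriv_eq)
  then have "(\<Sum>m\<in>UNIV. snd p $ m * dx m (dy l L) p) + dx l L p
      - 2 * (\<Sum>r\<in>UNIV. G r p * dy r (dy l L) p) - 2 * (\<Sum>r\<in>UNIV. dy l (G r) p * dy r L p) = 0"
    using p by (simp add: dy_rules dy_dx dy_dy[of L p l] sum.distrib)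
  then show ?thesis
    using spray_deriv_L_eq_dx[OF p, of l] p by (simp add: spray_deriv_eq)
qed

text \<open>By homogeneity G^i_{rm} y^m = G^i_r and G^r_m y^m = 2 G^r, so only first derivatives of
  the spray coefficients survive in the connection terms.\<close>

lemma hcov_1_3_contract:
  assumes T: "\<And>j i k l. sm (T j i k l)" and p: "p \<in> U"
  shows "(\<Sum>m\<in>UNIV. hcov_1_3 f T j i k l m p * snd p $ m) = spray_deriv (T j i k l) p
     + (\<Sum>r\<in>UNIV. T j r k l p * dy r (G i) p)
     - (\<Sum>r\<in>UNIV. T r i k l p * dy j (G r) p)
     - (\<Sum>r\<in>UNIV. T j i r l p * dy k (G r) p)
     - (\<Sum>r\<in>UNIV. T j i k r p * dy l (G r) p)"
proof -
  have aux: "(\<Sum>m\<in>UNIV. (\<Sum>r\<in>UNIV. a r * c r m) * snd p $ m) =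
      (\<Sum>r\<in>UNIV. a r * (\<Sum>m\<in>UNIV. snd p $ m * c r m))" for a :: "'n \<Rightarrow> real" and c
    unfolding sum_distrib_left sum_distrib_right by (subst sum.swap) (simp add: ac_simps)
  have 1: "(\<Sum>m\<in>UNIV. (\<Sum>r\<in>UNIV. spray_coeff1 f r m p * dy r (T j i k l) p) * snd p $ m) =
      2 * (\<Sum>r\<in>UNIV. G r p * dy r (T j i k l) p)"
    using aux[of "\<lambda>r. dy r (T j i k l) p" "\<lambda>r m. dy m (G r) p"] euler_G0[OF p]
    by (simp add: spray_coeff1_def mult.commute sum_distrib_left mult.left_commute)
  show ?thesis
    using p T unfolding hcov_1_3_def hderiv_def
    by (simp add: left_diff_distrib distrib_right sum.distrib sum_subtractf 1)
      (simp add: aux spray_coeff2_def euler_G1 spray_deriv_eq mult.commute[of "dx _ _ _"])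
qed

section \<open>Derivatives of the Riemann curvature and the Berwald curvature\<close>

lemma sm_K [simp]: "sm (K i k)"
  by (simp add: riem2_def[abs_def])

lemma sm_B [simp]: "sm (B j i k l)"
  by (simp add: berwald_curv_def)

lemma dy_K:
  assumes p: "p \<in> U"
  shows "dy l (K i k) p = 2 * dx k (dy l (G i)) p - dx l (dy k (G i)) p
    - (\<Sum>r\<in>UNIV. snd p $ r * dx r (dy l (dy k (G i))) p)
    + 2 * (\<Sum>r\<in>UNIV. G r p * dy l (dy r (dy k (G i))) p)
    + 2 * (\<Sum>r\<in>UNIV. dy l (G r) p * dy r (dy k (G i)) p)
    - (\<Sum>r\<in>UNIV. dy r (G i) p * dy l (dy k (G r)) p)
    - (\<Sum>r\<in>UNIV. dy l (dy r (G i)) p * dy k (G r) p)"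
  using p unfolding riem2_def[abs_def]
  by (simp add: dy_rules dy_dx sum.distrib algebra_simps)

text \<open>The x-derivatives of second derivatives of G carry the coefficients 2, -1, -1, and so do
  the products of two second derivatives; both groups vanish under cyclic summation over
  \<open>j\<close>, \<open>l\<close>, \<open>k\<close>.\<close>

lemma dy_dy_K:
  assumes p: "p \<in> U"
  shows "dy j (dy l (K i k)) p = 2 * dx k (dy j (dy l (G i))) p - dx l (dy j (dy k (G i))) p
    - dx j (dy l (dy k (G i))) p
    - (\<Sum>r\<in>UNIV. snd p $ r * dx r (dy j (dy l (dy k (G i)))) p)
    + 2 * (\<Sum>r\<in>UNIV. G r p * dy j (dy l (dy r (dy k (G i)))) p)
    + 2 * (\<Sum>r\<in>UNIV. dy j (G r) p * dy l (dy r (dy k (G i))) p)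
    + 2 * (\<Sum>r\<in>UNIV. dy l (G r) p * dy j (dy r (dy k (G i))) p)
    + 2 * (\<Sum>r\<in>UNIV. dy j (dy l (G r)) p * dy r (dy k (G i)) p)
    - (\<Sum>r\<in>UNIV. dy r (G i) p * dy j (dy l (dy k (G r))) p)
    - (\<Sum>r\<in>UNIV. dy j (dy r (G i)) p * dy l (dy k (G r)) p)
    - (\<Sum>r\<in>UNIV. dy l (dy r (G i)) p * dy j (dy k (G r)) p)
    - (\<Sum>r\<in>UNIV. dy j (dy l (dy r (G i))) p * dy k (G r) p)"
  by (rule trans[OF dy_cong[OF dy_K p]], assumption)
    (use p in \<open>simp add: dy_rules dy_dx sum.distrib algebra_simps\<close>)

text \<open>Adding the three cyclic permutations of the second derivatives of the Riemann curvature
  cancels all terms but those of the covariant derivative of the Berwald curvature along the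
  spray.\<close>

lemma berwald_curv_spray_derivative:
  assumes p: "p \<in> U"
  shows "3 * (\<Sum>m\<in>UNIV. hcov_1_3 f B j i k l m p * snd p $ m) =
    - (dy j (dy l (K i k)) p + dy k (dy j (K i l)) p + dy l (dy k (K i j)) p)"
proof -
  \<comment> \<open>The symmetries of mixed derivatives serve as permutative rewrite rules that
    bring each term to a normal form.\<close>
  have s2: "dy a (dy b (G r)) p = dy b (dy a (G r)) p" for a b r
    using p by (simp add: dy_dy)
  have s3: "dy a (dy b (dy c (G r))) p = dy a (dy c (dy b (G r))) p"
    "dy a (dy b (dy c (G r))) p = dy b (dy a (dy c (G r))) p" for a b c r
    by (rule dy_cong[OF dy_dy], simp_all add: p) (rule dy_dy, simp_all add: p)
  have s4: "dy a (dy b (dy c (dy d (G r)))) p = dy a (dy b (dy d (dy c (G r)))) p"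
    "dy a (dy b (dy c (dy d (G r)))) p = dy a (dy c (dy b (dy d (G r)))) p"
    "dy a (dy b (dy c (dy d (G r)))) p = dy b (dy a (dy c (dy d (G r)))) p" for a b c d r
      apply (rule dy_cong[OF dy_cong[OF dy_dy]], simp_all add: p)
     apply (rule dy_cong[OF dy_dy], simp_all add: p)
    apply (rule dy_dy, simp_all add: p)
    done
  have x2: "dx a (dy b (dy c (G r))) p = dx a (dy c (dy b (G r))) p" for a b c r
    by (rule dx_cong[OF dy_dy]) (simp_all add: p)
  have x3: "dx a (dy b (dy c (dy d (G r)))) p = dx a (dy b (dy d (dy c (G r)))) p"
    "dx a (dy b (dy c (dy d (G r)))) p = dx a (dy c (dy b (dy d (G r)))) p" for a b c d r
     apply (rule dx_cong[OF dy_cong[OF dy_dy]], simp_all add: p)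
    apply (rule dx_cong[OF dy_dy], simp_all add: p)
    done
  \<comment> \<open>The surviving coefficients are multiples of 3: for each lower index the terms
    with a first derivative of G over that index contribute 2 + 2 - 1.\<close>
  show ?thesis
    unfolding hcov_1_3_contract[OF sm_B p] dy_dy_K[OF p]
    using p by (simp add: berwald_curv_def spray_deriv_eq s2 s3 s4 x2 x3 mult.commute)
qed

section \<open>Curvature when W-tilde vanishes\<close>

lemma sm_riem4 [simp]: "sm (riem4 f j i k l)"
  by (simp add: riem4_def[abs_def] sm_dy)

lemma sm_ricci [simp]: "sm (ricci f j k)"
  by (simp add: ricci_def[abs_def])

lemma sm_ricci_tilde [simp]: "sm (ricci_tilde f j k)"
  by (simp add: ricci_tilde_def[abs_def])

lemma euler_K: "euler_on U 2 (K i k)"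
proof -
  have 1: "euler_on U 1 (dy k (G i))" for k i
    using euler_on_dy[OF sm_G euler_G] by simp
  have 2: "euler_on U 0 (dy j (dy k (G i)))" for j k i
    using euler_on_dy[OF sm_dy[OF sm_G] 1] by simp
  show ?thesis
    unfolding riem2_def[abs_def]
    by (intro euler_on_diff euler_on_add)
      (auto intro!: euler_on_sum euler_on_mult[OF _ _ euler_on_const euler_on_sum]
        euler_on_mult[OF _ _ euler_on_const euler_on_dx] euler_on_mult[OF _ _ euler_on_coord euler_on_dx]
        euler_on_mult[OF _ _ euler_G 2] euler_on_mult[OF _ _ 1 1] 1 euler_G)
qed

text \<open>Two y-derivatives of a curvature of degree 2 have degree 0. Hence the derivative term of
  \<open>ricci_tilde\<close> disappears after contraction with y.\<close>

lemma euler_ricci: "euler_on U 0 (ricci f j k)"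
proof -
  have 1: "euler_on U 1 (dy l (K i k))" for i k l
    using euler_on_dy[OF sm_K euler_K] by simp
  have "euler_on U (1 - 1) (dy j (\<lambda>q. dy l (K i k) q - dy k (K i l) q))" for i k l
    by (intro euler_on_dy euler_on_diff 1) simp_all
  then show ?thesis
    unfolding ricci_def[abs_def] riem4_def[abs_def]
    by (intro euler_on_sum euler_on_mult[OF _ _ euler_on_const]) simp_all
qed

lemma euler_ricci_tilde: "euler_on U 0 (ricci_tilde f j k)"
  unfolding ricci_tilde_def[abs_def]
  by (auto intro!: euler_on_add euler_on_sum euler_on_mult[OF _ _ euler_on_const euler_ricci]
      euler_on_mult[OF _ _ euler_on_coord euler_on_dy[OF _ euler_ricci]] euler_ricci)

text \<open>If \<open>K\<^sup>i\<^sub>k = y\<^sup>i \<tau>\<^sub>k + \<delta>\<^sup>i\<^sub>k R\<close> with \<open>R = - \<tau>\<^sub>k y\<^sup>k\<close>, then \<open>K\<^sub>j\<^sub>k\<close> is a third of the \<open>y\<close>-derivative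
  of \<open>v\<^sub>k = (n - 2) \<partial>R/\<partial>y\<^sup>k - (n + 1) \<tau>\<^sub>k\<close>, whence the contraction of \<open>ricci_tilde\<close> with \<open>y\<close> is
  \<open>(n\<^sup>2 - 1) (\<partial>R/\<partial>y\<^sup>k - \<tau>\<^sub>k) / 3\<close>. When this is also \<open>(1 - n\<^sup>2) \<tau>\<^sub>k\<close>, it determines \<open>\<tau>\<close>.\<close>

lemma W_tilde_zero_imp_riem2:
  assumes W: "\<And>p i k. p \<in> U \<Longrightarrow> W_tilde f i k p = 0" and n: "CARD('n) > 1"
  obtains R where "sm R"
    and "\<And>p i k. p \<in> U \<Longrightarrow> K i k p = (if i = k then 1 else 0) * R p - 1/2 * (snd p $ i * dy k R p)"
proof -
  define n where "n = real CARD('n)"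
  have n1: "n > 1" using assms(2) by (simp add: n_def)
  define c where "c = 1 / (1 - n\<^sup>2)"
  have c: "c * (1 - n\<^sup>2) = 1"
    using n1 by (simp add: c_def power2_eq_square) (smt (verit) mult_less_cancel_left1)
  define \<tau> where "\<tau> k p = c * (\<Sum>j\<in>UNIV. ricci_tilde f j k p * snd p $ j)" for k p
  define R where "R p = - (\<Sum>k\<in>UNIV. snd p $ k * \<tau> k p)" for p
  have sm_\<tau> [simp]: "sm (\<tau> k)" for k
    by (simp add: \<tau>_def[abs_def])
  have R_eq: "R = (\<lambda>p. (-1) * (\<Sum>k\<in>UNIV. snd p $ k * \<tau> k p))"
    by (simp add: R_def fun_eq_iff)
  have sm_R [simp]: "sm R"
    unfolding R_eq by (intro sm_intros sm_coord sm_\<tau>)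
  have euler_\<tau>: "euler_on U 1 (\<tau> k)" for k
    unfolding \<tau>_def[abs_def]
    by (auto intro!: euler_on_sum euler_on_mult[OF _ _ euler_on_const euler_on_sum]
      euler_on_mult[OF _ _ euler_ricci_tilde euler_on_coord])
  have euler_R: "euler_on U 2 R"
    unfolding R_eq
    by (rule euler_on_mult[OF sm_intros(1) _ euler_on_const euler_on_sum])
      (auto intro!: euler_on_mult[OF _ _ euler_on_coord euler_\<tau>])
  have K: "K i k p = snd p $ i * \<tau> k p + (if i = k then 1 else 0) * R p" if p: "p \<in> U" for i k p
  proof -
    have "(\<Sum>j\<in>UNIV. \<Sum>h\<in>UNIV. ricci_tilde f j h p * snd p $ j * snd p $ h) =
        (\<Sum>h\<in>UNIV. snd p $ h * (\<Sum>j\<in>UNIV. ricci_tilde f j h p * snd p $ j))"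
      unfolding sum_distrib_left by (subst sum.swap) (simp add: ac_simps)
    moreover have "R p = - c * (\<Sum>h\<in>UNIV. snd p $ h * (\<Sum>j\<in>UNIV. ricci_tilde f j h p * snd p $ j))"
      by (simp add: R_def \<tau>_def sum_distrib_left sum_negf[symmetric] ac_simps)
    ultimately show ?thesis
      using W[OF p, of i k] by (simp add: W_tilde_def n_def[symmetric] c_def[symmetric] \<tau>_def algebra_simps)
  qed
  \<comment> \<open>Taking the trace inside the derivative shows that the Ricci curvature is a third
    of \<open>dy j (v k)\<close>.\<close>
  define v where "v k q = (\<Sum>m\<in>UNIV. dy k (K m m) q - dy m (K m k) q)" for k q
  have sm_v [simp]: "sm (v k)" for k
    by (simp add: v_def[abs_def])
  have v: "v k p = (n - 2) * dy k R p - (n + 1) * \<tau> k p" if p: "p \<in> U" for k p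
  proof -
    have "(\<Sum>m\<in>UNIV. K m m q) = (n - 1) * R q" if "q \<in> U" for q
    proof -
      have "(\<Sum>m\<in>UNIV. snd q $ m * \<tau> m q) = - R q" by (simp add: R_def)
      then show ?thesis using that by (simp add: K sum.distrib n_def left_diff_distrib)
    qed
    then have "dy k (\<lambda>q. \<Sum>m\<in>UNIV. K m m q) p = dy k (\<lambda>q. (n - 1) * R q) p"
      by (intro dy_cong[OF _ p]) simp
    then have 1: "(\<Sum>m\<in>UNIV. dy k (K m m) p) = (n - 1) * dy k R p"
      using p by (simp add: dy_rules)
    have "dy m (K m k) p = \<tau> k p + snd p $ m * dy m (\<tau> k) p + (if m = k then 1 else 0) * dy m R p" for m
    proof -
      have "dy m (K m k) p = dy m (\<lambda>q. snd q $ m * \<tau> k q + (if m = k then 1 else 0) * R q) p"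
        by (rule dy_cong[OF K p])
      then show ?thesis using p by (simp add: dy_rules)
    qed
    then have "(\<Sum>m\<in>UNIV. dy m (K m k) p) = n * \<tau> k p + \<tau> k p + dy k R p"
      using euler_onD[OF euler_\<tau> p] by (simp add: sum.distrib n_def)
    with 1 show ?thesis
      by (simp add: v_def sum_subtractf algebra_simps)
  qed
  have ricci: "ricci f j k p = 1/3 * dy j (v k) p" if p: "p \<in> U" for j k p
    using p unfolding ricci_def riem4_def v_def[abs_def]
    by (simp add: dy_rules sum_divide_distrib)
  have euler_v: "euler_on U 1 (v k)" for k
  proof -
    have "euler_on U 1 (\<lambda>p. (n - 2) * dy k R p - (n + 1) * \<tau> k p)"
      by (auto intro!: euler_on_diff euler_on_mult[OF _ _ euler_on_const euler_on_dy[OF _ euler_R]]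
        euler_on_mult[OF _ _ euler_on_const euler_\<tau>])
    then show ?thesis
      by (subst euler_on_cong[OF v])
  qed
  have \<tau>: "\<tau> k p = - 1/2 * dy k R p" if p: "p \<in> U" for k p
  proof -
    \<comment> \<open>Euler's relation contracts dR to 2 R and \<open>\<tau>\<close> contracts to
      -R, so the factor is 2 (n - 2) + (n + 1) = 3 (n - 1).\<close>
    have yv: "(\<Sum>j\<in>UNIV. snd q $ j * v j q) = 3 * (n - 1) * R q" if q: "q \<in> U" for q
    proof -
      have "(\<Sum>j\<in>UNIV. snd q $ j * v j q) = (n - 2) * (\<Sum>j\<in>UNIV. snd q $ j * dy j R q)
          - (n + 1) * (\<Sum>j\<in>UNIV. snd q $ j * \<tau> j q)"
        using q by (simp add: v right_diff_distrib sum_subtractf sum_distrib_left mult.left_commute)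
      also have "\<dots> = 3 * (n - 1) * R q"
        using euler_onD[OF euler_R q] by (simp add: R_def algebra_simps)
      finally show ?thesis .
    qed
    have "dy k (\<lambda>q. \<Sum>j\<in>UNIV. snd q $ j * v j q) p = dy k (\<lambda>q. 3 * (n - 1) * R q) p"
      by (rule dy_cong[OF yv p])
    \<comment> \<open>In the transposed Ricci term of \<open>ricci_tilde\<close> the derivative
      carries the free index; differentiating the contracted identity moves y inside at the cost of
      one \<open>v k\<close>.\<close>
    then have t2: "(\<Sum>j\<in>UNIV. snd p $ j * dy k (v j) p) = 3 * (n - 1) * dy k R p - v k p"
      using p by (simp add: dy_rules sum.distrib)
    have t1: "(\<Sum>j\<in>UNIV. snd p $ j * dy j (v k) p) = v k p"
      using euler_onD[OF euler_v p] by simp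
    have t3: "(\<Sum>j\<in>UNIV. snd p $ j * (\<Sum>r\<in>UNIV. snd p $ r * dy j (ricci f k r) p)) = 0"
    proof -
      have "(\<Sum>j\<in>UNIV. snd p $ j * (\<Sum>r\<in>UNIV. snd p $ r * dy j (ricci f k r) p)) =
          (\<Sum>r\<in>UNIV. snd p $ r * (\<Sum>j\<in>UNIV. snd p $ j * dy j (ricci f k r) p))"
        unfolding sum_distrib_left by (subst sum.swap) (simp add: ac_simps)
      then show ?thesis
        using euler_onD[OF euler_ricci p] by simp
    qed
    have "(\<Sum>j\<in>UNIV. ricci_tilde f j k p * snd p $ j) =
        n / 3 * (\<Sum>j\<in>UNIV. snd p $ j * dy j (v k) p) + 1/3 * (\<Sum>j\<in>UNIV. snd p $ j * dy k (v j) p)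
        + (\<Sum>j\<in>UNIV. snd p $ j * (\<Sum>r\<in>UNIV. snd p $ r * dy j (ricci f k r) p))"
      unfolding ricci_tilde_def n_def[symmetric] ricci[OF p] sum_distrib_left[of "n / 3"]
        sum_distrib_left[of "1/3"] sum.distrib[symmetric]
      by (rule sum.cong) (simp_all add: algebra_simps)
    also have "\<dots> = (n\<^sup>2 - 1) / 3 * (dy k R p - \<tau> k p)"
      unfolding t1 t2 t3 v[OF p] by (simp add: field_simps power2_eq_square)
    finally have "\<tau> k p = c * ((n\<^sup>2 - 1) / 3 * (dy k R p - \<tau> k p))"
      by (simp only: \<tau>_def[of k p])
    also have "\<dots> = - (c * (1 - n\<^sup>2)) / 3 * (dy k R p - \<tau> k p)"
      by (simp add: field_simps)
    finally have "3 * \<tau> k p = \<tau> k p - dy k R p"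
      unfolding c by (simp add: field_simps)
    then show ?thesis by linarith
  qed
  show ?thesis
  proof (rule that[OF sm_R])
    fix p i k assume "p \<in> U"
    then show "K i k p = (if i = k then 1 else 0) * R p - 1/2 * (snd p $ i * dy k R p)"
      by (simp add: K \<tau>)
  qed
qed

lemma W_tilde_zero_imp_berwald:
  assumes W: "\<And>p i k. p \<in> U \<Longrightarrow> W_tilde f i k p = 0" and n: "CARD('n) > 1"
  obtains e where
    "\<And>p j i k l. p \<in> U \<Longrightarrow> (\<Sum>m\<in>UNIV. hcov_1_3 f B j i k l m p * snd p $ m) = e j k l p * snd p $ i"
proof -
  obtain R where R [simp]: "sm R"
    and K: "\<And>p i k. p \<in> U \<Longrightarrow> K i k p = (if i = k then 1 else 0) * R p - 1/2 * (snd p $ i * dy k R p)"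
    using W_tilde_zero_imp_riem2[OF assms] by blast
  have dK: "dy l (K i k) p = (if i = k then 1 else 0) * dy l R p
      - 1/2 * ((if i = l then 1 else 0) * dy k R p + snd p $ i * dy l (dy k R) p)" if p: "p \<in> U" for l i k p
    by (rule trans[OF dy_cong[OF K p]], assumption) (use p in \<open>simp add: dy_rules dy_divide\<close>)
  have ddK: "dy j (dy l (K i k)) p = (if i = k then 1 else 0) * dy j (dy l R) p
      - 1/2 * ((if i = l then 1 else 0) * dy j (dy k R) p + (if i = j then 1 else 0) * dy l (dy k R) p
         + snd p $ i * dy j (dy l (dy k R)) p)" if p: "p \<in> U" for j l i k p
    by (rule trans[OF dy_cong[OF dK p]], assumption) (use p in \<open>simp add: dy_rules dy_divide algebra_simps\<close>)
  show ?thesis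
  proof (rule that[of "\<lambda>j k l p. 1/6 * (dy j (dy l (dy k R)) p + dy k (dy j (dy l R)) p + dy l (dy k (dy j R)) p)"])
    fix p j i k l assume p: "p \<in> U"
    have s: "dy a (dy b R) p = dy b (dy a R) p" for a b
      using p by (simp add: dy_dy)
    \<comment> \<open>In the cyclic sum each Kronecker symbol occurs with the coefficients 1, -1/2
      and -1/2. What remains is -1/2 y^i times third derivatives of R; division by -3 gives the
      factor 1/6 of the witness.\<close>
    have "3 * (\<Sum>m\<in>UNIV. hcov_1_3 f B j i k l m p * snd p $ m) =
        1/2 * (dy j (dy l (dy k R)) p + dy k (dy j (dy l R)) p + dy l (dy k (dy j R)) p) * snd p $ i"
      unfolding berwald_curv_spray_derivative[OF p] ddK[OF p]
      by (simp add: s[of l k] s[of j l] s[of j k] algebra_simps)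
    then show "(\<Sum>m\<in>UNIV. hcov_1_3 f B j i k l m p * snd p $ m) =
        1/6 * (dy j (dy l (dy k R)) p + dy k (dy j (dy l R)) p + dy l (dy k (dy j R)) p) * snd p $ i"
      by (simp add: algebra_simps)
  qed
qed

end

section \<open>Splitting the Berwald curvature\<close>

text \<open>The derivative of F^2 is 2 y_s, which explains the 2 in the denominator. As y_s y^s =
  F^2, this is the coefficient that makes the remaining part of the curvature annihilated by
  y_s.\<close>

definition berwald_radial ::
    "('n::finite tpoint \<Rightarrow> real) \<Rightarrow> 'n \<Rightarrow> 'n \<Rightarrow> 'n \<Rightarrow> 'n tpoint \<Rightarrow> real" where
  "berwald_radial f j k l p =
     (\<Sum>s\<in>UNIV. dy s (\<lambda>q. (f q)\<^sup>2) p * berwald_curv f j s k l p) / (2 * (f p)\<^sup>2)"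

definition berwald_angular ::
    "('n::finite tpoint \<Rightarrow> real) \<Rightarrow> 'n \<Rightarrow> 'n \<Rightarrow> 'n \<Rightarrow> 'n \<Rightarrow> 'n tpoint \<Rightarrow> real" where
  "berwald_angular f j i k l p = berwald_curv f j i k l p - berwald_radial f j k l p * snd p $ i"

context finsler_chart
begin

lemma sm_radial [simp]: "sm (berwald_radial f j k l)"
  unfolding berwald_radial_def[abs_def] using L_pos by (intro sm_divide) (auto simp: less_le)

lemma sm_angular [simp]: "sm (berwald_angular f j i k l)"
  by (simp add: berwald_angular_def[abs_def])

lemma angular_spray_derivative:
  assumes e: "\<And>j i k l. (\<Sum>m\<in>UNIV. hcov_1_3 f B j i k l m p * snd p $ m) = e j k l * snd p $ i"
    and p: "p \<in> U"
  shows "(\<Sum>m\<in>UNIV. hcov_1_3 f (berwald_angular f) j i k l m p * snd p $ m) = 0"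
proof -
  let ?b = "berwald_radial f"
  have Lb: "(\<Sum>s\<in>UNIV. dy s L q * B j s k l q) = 2 * L q * ?b j k l q" if "q \<in> U" for q j k l
    using L_pos[OF that] by (simp add: berwald_radial_def)
  have DB: "spray_deriv (B j i k l) p = e j k l * snd p $ i
     - (\<Sum>r\<in>UNIV. B j r k l p * dy r (G i) p)
     + (\<Sum>r\<in>UNIV. B r i k l p * dy j (G r) p)
     + (\<Sum>r\<in>UNIV. B j i r l p * dy k (G r) p)
     + (\<Sum>r\<in>UNIV. B j i k r p * dy l (G r) p)" for j i k l
    using e[of j i k l] unfolding hcov_1_3_contract[OF sm_B p] by simp
  have Db: "spray_deriv (?b j k l) p = e j k l
     + (\<Sum>r\<in>UNIV. ?b r k l p * dy j (G r) p)
     + (\<Sum>r\<in>UNIV. ?b j r l p * dy k (G r) p)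
     + (\<Sum>r\<in>UNIV. ?b j k r p * dy l (G r) p)"
  proof -
    have swap: "(\<Sum>s\<in>UNIV. dy s L p * (\<Sum>r\<in>UNIV. T r s * g r)) = (\<Sum>r\<in>UNIV. (\<Sum>s\<in>UNIV. dy s L p * T r s) * g r)"
      for T :: "'n \<Rightarrow> 'n \<Rightarrow> real" and g
      unfolding sum_distrib_left sum_distrib_right by (subst sum.swap) (simp add: ac_simps)
    \<comment> \<open>The derivative of y_s cancels the connection term of the upper index of
      B.\<close>
    have cancel: "(\<Sum>s\<in>UNIV. (\<Sum>r\<in>UNIV. dy s (G r) p * dy r L p) * B j s k l p) =
        (\<Sum>s\<in>UNIV. dy s L p * (\<Sum>r\<in>UNIV. B j r k l p * dy r (G s) p))"
      unfolding sum_distrib_left sum_distrib_right by (subst sum.swap) (simp add: ac_simps)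
    have yL: "(\<Sum>s\<in>UNIV. dy s L p * (e j k l * snd p $ s)) = e j k l * (2 * L p)"
    proof -
      have "(\<Sum>s\<in>UNIV. dy s L p * (e j k l * snd p $ s)) = e j k l * (\<Sum>s\<in>UNIV. snd p $ s * dy s L p)"
        by (simp add: sum_distrib_left ac_simps)
      then show ?thesis using euler_onD[OF euler_L p] by simp
    qed
    have "spray_deriv (\<lambda>q. \<Sum>s\<in>UNIV. dy s L q * B j s k l q) p = spray_deriv (\<lambda>q. 2 * L q * ?b j k l q) p"
      by (rule spray_deriv_cong[OF Lb p])
    then have "(\<Sum>s\<in>UNIV. dy s L p * spray_deriv (B j s k l) p + spray_deriv (dy s L) p * B j s k l p) =
        2 * L p * spray_deriv (?b j k l) p"
      using p by (simp add: spray_deriv_rules spray_deriv_L)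
    also have "(\<Sum>s\<in>UNIV. dy s L p * spray_deriv (B j s k l) p + spray_deriv (dy s L) p * B j s k l p) =
      e j k l * (2 * L p)
      + (\<Sum>r\<in>UNIV. 2 * L p * ?b r k l p * dy j (G r) p)
      + (\<Sum>r\<in>UNIV. 2 * L p * ?b j r l p * dy k (G r) p)
      + (\<Sum>r\<in>UNIV. 2 * L p * ?b j k r p * dy l (G r) p)"
      unfolding DB spray_deriv_dy_L[OF p] distrib_left right_diff_distrib sum.distrib sum_subtractf
        yL swap[of "\<lambda>r s. B r s k l p"] swap[of "\<lambda>r s. B j s r l p"] swap[of "\<lambda>r s. B j s k r p"] Lb[OF p]
        cancel by simp
    finally have "2 * L p * spray_deriv (?b j k l) p = 2 * L p * (e j k l
       + (\<Sum>r\<in>UNIV. ?b r k l p * dy j (G r) p)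
       + (\<Sum>r\<in>UNIV. ?b j r l p * dy k (G r) p)
       + (\<Sum>r\<in>UNIV. ?b j k r p * dy l (G r) p))"
      by (simp add: distrib_left sum_distrib_left ac_simps)
    then show ?thesis using L_pos[OF p] by simp
  qed
  \<comment> \<open>This is D y^i = 0: the spray derivative of y^i is -2 G^i, and the connection
    term adds 2 G^i.\<close>
  have y: "(\<Sum>r\<in>UNIV. ?b j k l p * snd p $ r * dy r (G i) p) = ?b j k l p * (2 * G i p)"
    using euler_G0[OF p] by (simp add: mult.assoc sum_distrib_left[symmetric])
  have z: "(\<Sum>r\<in>UNIV. T r * snd p $ i * g r) = (\<Sum>r\<in>UNIV. T r * g r) * snd p $ i"
    for T g :: "'n \<Rightarrow> real"
    unfolding sum_distrib_right by (simp add: ac_simps)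
  have "spray_deriv (berwald_angular f j i k l) p =
      spray_deriv (B j i k l) p - (?b j k l p * (- 2 * G i p) + spray_deriv (?b j k l) p * snd p $ i)"
    using p by (simp add: berwald_angular_def[abs_def] spray_deriv_rules)
  then show ?thesis
    unfolding hcov_1_3_contract[OF sm_angular p] DB Db berwald_angular_def left_diff_distrib
      sum_subtractf y z
    by algebra
qed

end

section \<open>Change of charts\<close>

lemma C_diff_on_subset: "C_diff_on k S f \<Longrightarrow> T \<subseteq> S \<Longrightarrow> C_diff_on k T f"
  by (induction k arbitrary: f) (auto intro: continuous_on_subset)

lemma smooth_on_subset: "smooth_on S f \<Longrightarrow> T \<subseteq> S \<Longrightarrow> smooth_on T f"
  unfolding smooth_on_def using C_diff_on_subset by metis

lemma frechet_derivative_compose_fst: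
  assumes "h differentiable (at (fst p))"
  shows "(\<lambda>p. h (fst p)) differentiable (at p)"
    and "frechet_derivative (\<lambda>p. h (fst p)) (at p) v = frechet_derivative h (at (fst p)) (fst v)"
proof -
  have "((\<lambda>p. h (fst p)) has_derivative (\<lambda>v. frechet_derivative h (at (fst p)) (fst v))) (at p)"
    using has_derivative_compose[OF has_derivative_fst[OF has_derivative_ident]
        has_derivative_frechet_derivative[OF assms]] .
  then show "(\<lambda>p. h (fst p)) differentiable (at p)"
    and "frechet_derivative (\<lambda>p. h (fst p)) (at p) v = frechet_derivative h (at (fst p)) (fst v)"
    by (auto simp: differentiable_def frechet_derivative_eqI)
qed

text \<open>Makes Jacobians and Hessians of coordinate changes smooth on the tangent bundle.
  Pullbacks from another chart are handled through differentiability alone.\<close>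

lemma smooth_on_compose_fst:
  assumes "open S" "open T" "smooth_on S h"
  shows "smooth_on (S \<times> T) (\<lambda>p. h (fst p))"
proof -
  have "C_diff_on k (S \<times> T) (\<lambda>p. h (fst p))" if "C_diff_on k S h" for k
    using that
  proof (induction k arbitrary: h)
    case 0
    then show ?case
      by (auto intro: continuous_on_compose2[OF _ continuous_on_fst[OF continuous_on_id]])
  next
    case (Suc k)
    have 1: "h differentiable (at (fst p))" if "p \<in> S \<times> T" for p
      using Suc.prems that by auto
    have "C_diff_on k (S \<times> T) (\<lambda>p. frechet_derivative h (at (fst p)) (fst v))" for v
      using Suc.IH[of "\<lambda>x. frechet_derivative h (at x) (fst v)"] Suc.prems by simp
    then have "C_diff_on k (S \<times> T) (\<lambda>p. frechet_derivative (\<lambda>p. h (fst p)) (at p) v)" for v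
      by (subst C_diff_on_cong[OF open_Times[OF assms(1,2)] frechet_derivative_compose_fst(2)[OF 1]])
    then show ?case
      using frechet_derivative_compose_fst(1)[OF 1] by simp
  qed
  with assms(3) show ?thesis by (simp add: smooth_on_def)
qed

lemma sum_mult_axis [simp]:
  fixes a :: "'n::finite \<Rightarrow> real"
  shows "(\<Sum>x\<in>UNIV. a x * axis x 1 $ q) = a q" "(\<Sum>x\<in>UNIV. a x * axis q 1 $ x) = a q"
  by (simp_all add: axis_def)

section \<open>A coordinate change and its lift to the tangent bundle\<close>

locale chart_change =
  fixes X :: "(real ^ 'n::finite) set" and \<phi> :: "real ^ 'n \<Rightarrow> real ^ 'n"
  assumes open_X: "open X" and smooth_\<phi>: "smooth_on X \<phi>"
begin

definition J :: "'n \<Rightarrow> 'n \<Rightarrow> real ^ 'n \<Rightarrow> real" where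
  "J q j x = frechet_derivative \<phi> (at x) (axis j 1) $ q"

definition H :: "'n \<Rightarrow> 'n \<Rightarrow> 'n \<Rightarrow> real ^ 'n \<Rightarrow> real" where
  "H q j l x = frechet_derivative (J q j) (at x) (axis l 1)"

text \<open>The tangent map of \<open>\<phi>\<close>, expanded in components so that the product
  rule yields its derivative. Over the overlap it agrees with
  \<open>tangent_transition\<close>.\<close>

definition \<Phi> :: "'n tpoint \<Rightarrow> 'n tpoint" where
  "\<Phi> p = (\<phi> (fst p), \<Sum>q\<in>UNIV. (\<Sum>j\<in>UNIV. J q j (fst p) * snd p $ j) *\<^sub>R axis q 1)"

lemma smooth_J: "smooth_on X (J q j)"
  unfolding J_def[abs_def]
  by (intro smooth_on_bounded_linear[OF open_X bounded_linear_vec_nth] smooth_on_frechet_derivative smooth_\<phi>)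

lemma smooth_H: "smooth_on X (H q j l)"
  unfolding H_def[abs_def] by (rule smooth_on_frechet_derivative[OF smooth_J])

lemma H_commute:
  assumes "x \<in> X"
  shows "H q j l x = H q l j x"
proof -
  have sm: "smooth_on X (\<lambda>x. \<phi> x $ q)"
    by (rule smooth_on_bounded_linear[OF open_X bounded_linear_vec_nth smooth_\<phi>])
  have J: "J q j x = frechet_derivative (\<lambda>x. \<phi> x $ q) (at x) (axis j 1)" if "x \<in> X" for j x
    unfolding J_def
    by (rule frechet_derivative_bounded_linear_compose[OF bounded_linear_vec_nth, symmetric])
      (rule smooth_on_differentiable[OF smooth_\<phi> that])
  have "H q j l x = frechet_derivative (\<lambda>x. frechet_derivative (\<lambda>x. \<phi> x $ q) (at x) (axis j 1)) (at x) (axis l 1)" for j l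
    unfolding H_def by (simp add: frechet_derivative_cong_open[OF open_X assms J])
  then show ?thesis
    using frechet_derivative_commute[OF open_X sm assms] by metis
qed

lemma frechet_derivative_\<phi>:
  assumes "x \<in> X"
  shows "frechet_derivative \<phi> (at x) y $ q = (\<Sum>j\<in>UNIV. J q j x * y $ j)"
proof -
  interpret linear "frechet_derivative \<phi> (at x)"
    by (rule linear_frechet_derivative[OF smooth_on_differentiable[OF smooth_\<phi> assms]])
  have "frechet_derivative \<phi> (at x) y = frechet_derivative \<phi> (at x) (\<Sum>m\<in>UNIV. (y $ m) *\<^sub>R axis m 1)"
    using vec_eq_sum_axis[of y] by simp
  then show ?thesis
    by (simp add: sum scale J_def mult.commute)
qed

lemma snd_\<Phi>: "snd (\<Phi> p) $ q = (\<Sum>j\<in>UNIV. J q j (fst p) * snd p $ j)"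
  by (simp add: \<Phi>_def)

lemma has_derivative_\<Phi>:
  assumes "fst p \<in> X"
  shows "(\<Phi> has_derivative (\<lambda>v. (frechet_derivative \<phi> (at (fst p)) (fst v),
     \<Sum>q\<in>UNIV. (\<Sum>j\<in>UNIV. J q j (fst p) * snd v $ j
       + frechet_derivative (J q j) (at (fst p)) (fst v) * snd p $ j) *\<^sub>R axis q 1))) (at p)"
proof -
  have fst: "((\<lambda>p. h (fst p)) has_derivative (\<lambda>v. frechet_derivative h (at (fst p)) (fst v))) (at p)"
    if "smooth_on X h" for h :: "real ^ 'n \<Rightarrow> 'b::real_normed_vector"
    using has_derivative_compose[OF has_derivative_fst[OF has_derivative_ident]
        has_derivative_frechet_derivative[OF smooth_on_differentiable[OF that assms]]] .
  have nth: "((\<lambda>p. snd p $ j) has_derivative (\<lambda>v. snd v $ j)) (at p)" for j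
    by (intro bounded_linear_imp_has_derivative bounded_linear_compose[OF bounded_linear_vec_nth bounded_linear_snd])
  show ?thesis
    unfolding \<Phi>_def[abs_def]
    by (intro has_derivative_Pair fst smooth_\<phi> has_derivative_sum has_derivative_scaleR_left
        has_derivative_mult smooth_J nth)
qed

lemma frechet_derivative_compose_\<Phi>:
  assumes p: "fst p \<in> X" and h: "h differentiable (at (\<Phi> p))"
  shows "(\<lambda>p. h (\<Phi> p)) differentiable (at p)"
    and "frechet_derivative (\<lambda>p. h (\<Phi> p)) (at p) v =
      (\<Sum>q\<in>UNIV. (\<Sum>j\<in>UNIV. J q j (fst p) * fst v $ j) * dx q h (\<Phi> p))
      + (\<Sum>q\<in>UNIV. (\<Sum>j\<in>UNIV. J q j (fst p) * snd v $ j
          + frechet_derivative (J q j) (at (fst p)) (fst v) * snd p $ j) * dy q h (\<Phi> p))"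
proof -
  note * = has_derivative_compose[OF has_derivative_\<Phi>[OF p] has_derivative_frechet_derivative[OF h]]
  show "(\<lambda>p. h (\<Phi> p)) differentiable (at p)"
    using * unfolding differentiable_def by blast
  show "frechet_derivative (\<lambda>p. h (\<Phi> p)) (at p) v =
      (\<Sum>q\<in>UNIV. (\<Sum>j\<in>UNIV. J q j (fst p) * fst v $ j) * dx q h (\<Phi> p))
      + (\<Sum>q\<in>UNIV. (\<Sum>j\<in>UNIV. J q j (fst p) * snd v $ j
          + frechet_derivative (J q j) (at (fst p)) (fst v) * snd p $ j) * dy q h (\<Phi> p))"
    using frechet_derivative_eqI[OF *, of v]
    by (simp add: frechet_derivative_eq_sum[OF h] frechet_derivative_\<phi>[OF p])
qed

lemma dy_compose_\<Phi>:
  assumes "fst p \<in> X" "h differentiable (at (\<Phi> p))"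
  shows "dy l (\<lambda>p. h (\<Phi> p)) p = (\<Sum>q\<in>UNIV. J q l (fst p) * dy q h (\<Phi> p))"
proof -
  have "frechet_derivative (J q j) (at (fst p)) 0 = 0" for q j
    using linear_0[OF linear_frechet_derivative[OF smooth_on_differentiable[OF smooth_J assms(1)]]] .
  then show ?thesis
    using frechet_derivative_compose_\<Phi>(2)[OF assms, of "(0, axis l 1)"]
    by (simp add: dy_def[of l])
qed

text \<open>The new fibre coordinates depend on x through the Jacobian. The resulting Hessian term
  is the source of the inhomogeneous law for the spray coefficients.\<close>

lemma dx_compose_\<Phi>:
  assumes "fst p \<in> X" "h differentiable (at (\<Phi> p))"
  shows "dx l (\<lambda>p. h (\<Phi> p)) p = (\<Sum>q\<in>UNIV. J q l (fst p) * dx q h (\<Phi> p))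
    + (\<Sum>q\<in>UNIV. (\<Sum>j\<in>UNIV. H q j l (fst p) * snd p $ j) * dy q h (\<Phi> p))"
  using frechet_derivative_compose_\<Phi>(2)[OF assms, of "(axis l 1, 0)"]
  by (simp add: dx_def[of l] H_def)

lemma frechet_derivative_sum_fst_mult:
  fixes a :: "'n \<Rightarrow> real ^ 'n \<Rightarrow> real" and h :: "'n \<Rightarrow> 'n tpoint \<Rightarrow> real"
  assumes p: "fst p \<in> X" and a: "\<And>i. smooth_on X (a i)" and h: "\<And>i. h i differentiable (at p)"
  shows "frechet_derivative (\<lambda>p. \<Sum>i\<in>UNIV. a i (fst p) * h i p) (at p) v =
    (\<Sum>i\<in>UNIV. a i (fst p) * frechet_derivative (h i) (at p) v
      + frechet_derivative (a i) (at (fst p)) (fst v) * h i p)"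
proof -
  note a' = smooth_on_differentiable[OF a p]
  show ?thesis
    by (subst frechet_derivative_sum)
      (simp_all add: frechet_derivative_mult h frechet_derivative_compose_fst[OF a'] differentiable_mult)
qed

lemma dy_sum_J_mult:
  assumes "fst p \<in> X" "\<And>i. h i differentiable (at p)"
  shows "dy l (\<lambda>p. \<Sum>i\<in>UNIV. J i d (fst p) * h i p) p = (\<Sum>i\<in>UNIV. J i d (fst p) * dy l (h i) p)"
proof -
  have "frechet_derivative (J q j) (at (fst p)) 0 = 0" for q j
    using linear_0[OF linear_frechet_derivative[OF smooth_on_differentiable[OF smooth_J assms(1)]]] .
  then show ?thesis
    using frechet_derivative_sum_fst_mult[OF assms(1), of "\<lambda>i. J i d" h "(0, axis l 1)"]
      smooth_J assms(2) by (simp add: dy_def)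
qed

lemma dx_sum_J_mult:
  assumes "fst p \<in> X" "\<And>i. h i differentiable (at p)"
  shows "dx l (\<lambda>p. \<Sum>i\<in>UNIV. J i d (fst p) * h i p) p =
    (\<Sum>i\<in>UNIV. J i d (fst p) * dx l (h i) p + H i d l (fst p) * h i p)"
  using frechet_derivative_sum_fst_mult[OF assms(1), of "\<lambda>i. J i d" h "(axis l 1, 0)"]
      smooth_J assms(2) by (simp add: dx_def H_def)

end

section \<open>Comparison of two Finsler charts\<close>

lemma sum_triple_rotate:
  fixes a g :: "'n::finite \<Rightarrow> real" and b T :: "'n \<Rightarrow> 'n \<Rightarrow> real"
  shows "(\<Sum>i\<in>UNIV. (\<Sum>q\<in>UNIV. a q * (\<Sum>r\<in>UNIV. b r i * T r q)) * g i) =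
    (\<Sum>q\<in>UNIV. a q * (\<Sum>r\<in>UNIV. T r q * (\<Sum>i\<in>UNIV. b r i * g i)))"
proof -
  have "(\<Sum>i\<in>UNIV. (\<Sum>q\<in>UNIV. a q * (\<Sum>r\<in>UNIV. b r i * T r q)) * g i) =
      (\<Sum>i\<in>UNIV. \<Sum>q\<in>UNIV. \<Sum>r\<in>UNIV. a q * (T r q * (b r i * g i)))"
    by (simp add: sum_distrib_left sum_distrib_right ac_simps)
  also have "\<dots> = (\<Sum>q\<in>UNIV. \<Sum>i\<in>UNIV. \<Sum>r\<in>UNIV. a q * (T r q * (b r i * g i)))"
    by (rule sum.swap)
  also have "\<dots> = (\<Sum>q\<in>UNIV. \<Sum>r\<in>UNIV. \<Sum>i\<in>UNIV. a q * (T r q * (b r i * g i)))"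
    by (intro sum.cong refl sum.swap)
  also have "\<dots> = (\<Sum>q\<in>UNIV. a q * (\<Sum>r\<in>UNIV. T r q * (\<Sum>i\<in>UNIV. b r i * g i)))"
    by (simp add: sum_distrib_left)
  finally show ?thesis .
qed

text \<open>\<open>J'\<close> stands for the Jacobian of the reverse change at the corresponding
  point; it enters only through the two matrix identities.\<close>

locale finsler_change =
  chart_change X \<phi> + src: finsler_chart V f + tgt: finsler_chart V' f'
  for X :: "(real ^ 'n::finite) set" and \<phi>
    and V :: "(real ^ 'n) set" and f and V' :: "(real ^ 'n) set" and f' +
  fixes J' :: "'n \<Rightarrow> 'n \<Rightarrow> real ^ 'n \<Rightarrow> real"
  assumes X_subset: "X \<subseteq> V" and \<phi>_image: "\<phi> ` X \<subseteq> V'"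
    and f_eq: "\<And>p. fst p \<in> X \<Longrightarrow> f p = f' (\<Phi> p)"
    and J_J': "\<And>x q s. x \<in> X \<Longrightarrow> (\<Sum>l\<in>UNIV. J q l x * J' l s x) = (if q = s then 1 else 0)"
    and J'_J: "\<And>x q s. x \<in> X \<Longrightarrow> (\<Sum>l\<in>UNIV. J' q l x * J l s x) = (if q = s then 1 else 0)"
begin

abbreviation W :: "'n tpoint set" where "W \<equiv> X \<times> (- {0})"

sublocale ov: tangent_open W
  by unfold_locales (intro open_Times open_X open_Compl closed_singleton)

abbreviation L' :: "'n tpoint \<Rightarrow> real" where "L' \<equiv> \<lambda>q. (f' q)\<^sup>2"

lemma fst_W: "p \<in> W \<Longrightarrow> fst p \<in> X"
  by auto

lemma W_subset: "W \<subseteq> src.U"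
  using X_subset by auto

lemma J'_contract:
  assumes "x \<in> X"
  shows "(\<Sum>q\<in>UNIV. J' s q x * (\<Sum>l\<in>UNIV. J q l x * a l)) = a s"
proof -
  have "(\<Sum>q\<in>UNIV. J' s q x * (\<Sum>l\<in>UNIV. J q l x * a l)) =
      (\<Sum>l\<in>UNIV. (\<Sum>q\<in>UNIV. J' s q x * J q l x) * a l)"
    unfolding sum_distrib_left sum_distrib_right by (subst sum.swap) (simp add: mult.assoc)
  then show ?thesis by (simp add: J'_J[OF assms])
qed

lemma J_cancel:
  assumes x: "x \<in> X" and eq: "\<And>l. (\<Sum>q\<in>UNIV. J q l x * a q) = (\<Sum>q\<in>UNIV. J q l x * b q)"
  shows "a s = b s"
proof -
  have *: "(\<Sum>l\<in>UNIV. J' l s x * (\<Sum>q\<in>UNIV. J q l x * a q)) = a s" for a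
  proof -
    have "(\<Sum>l\<in>UNIV. J' l s x * (\<Sum>q\<in>UNIV. J q l x * a q)) =
        (\<Sum>q\<in>UNIV. (\<Sum>l\<in>UNIV. J q l x * J' l s x) * a q)"
      unfolding sum_distrib_left sum_distrib_right by (subst sum.swap) (simp add: ac_simps)
    then show ?thesis by (simp add: J_J'[OF x])
  qed
  show ?thesis
    using *[of a] *[of b] eq by simp
qed

lemma \<Phi>_in: assumes p: "p \<in> W" shows "\<Phi> p \<in> tgt.U"
proof -
  have "snd (\<Phi> p) \<noteq> 0"
  proof
    assume "snd (\<Phi> p) = 0"
    then have "(\<Sum>j\<in>UNIV. J q j (fst p) * snd p $ j) = 0" for q
      by (simp flip: snd_\<Phi>)
    then have "snd p $ s = 0" for s
      using J'_contract[OF fst_W[OF p], of s "\<lambda>j. snd p $ j"] by simp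
    then have "snd p = 0" by (simp add: vec_eq_iff)
    with p show False by auto
  qed
  moreover have "fst (\<Phi> p) \<in> V'"
    using fst_W[OF p] \<phi>_image by (auto simp: \<Phi>_def)
  ultimately show ?thesis
    by (metis ComplI mem_Times_iff singletonD)
qed

lemma diff_tgt: "tgt.sm h \<Longrightarrow> p \<in> W \<Longrightarrow> h differentiable (at (\<Phi> p))"
  using \<Phi>_in smooth_on_differentiable by blast

lemma diff_compose:
  fixes h :: "'n tpoint \<Rightarrow> real"
  shows "tgt.sm h \<Longrightarrow> p \<in> W \<Longrightarrow> (\<lambda>p. h (\<Phi> p)) differentiable (at p)"
  by (rule frechet_derivative_compose_\<Phi>(1)[OF fst_W diff_tgt])

lemma dy_compose: "tgt.sm h \<Longrightarrow> p \<in> W \<Longrightarrow>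
    dy l (\<lambda>p. h (\<Phi> p)) p = (\<Sum>q\<in>UNIV. J q l (fst p) * dy q h (\<Phi> p))"
  by (intro dy_compose_\<Phi> fst_W diff_tgt)

definition N :: "'n \<Rightarrow> 'n \<Rightarrow> 'n tpoint \<Rightarrow> real" where
  "N q l p = (\<Sum>j\<in>UNIV. H q j l (fst p) * snd p $ j)"

lemma dx_compose: "tgt.sm h \<Longrightarrow> p \<in> W \<Longrightarrow> dx l (\<lambda>p. h (\<Phi> p)) p =
    (\<Sum>q\<in>UNIV. J q l (fst p) * dx q h (\<Phi> p)) + (\<Sum>q\<in>UNIV. N q l p * dy q h (\<Phi> p))"
  unfolding N_def by (intro dx_compose_\<Phi> fst_W diff_tgt)

lemma L_eq: "p \<in> W \<Longrightarrow> src.L p = L' (\<Phi> p)"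
  using f_eq[OF fst_W] by simp

lemma dy_L:
  assumes p: "p \<in> W"
  shows "dy l src.L p = (\<Sum>q\<in>UNIV. J q l (fst p) * dy q L' (\<Phi> p))"
  using ov.dy_cong[OF L_eq p] dy_compose[OF tgt.sm_L p] by simp

lemma dx_L:
  assumes p: "p \<in> W"
  shows "dx l src.L p = (\<Sum>q\<in>UNIV. J q l (fst p) * dx q L' (\<Phi> p)) + (\<Sum>q\<in>UNIV. N q l p * dy q L' (\<Phi> p))"
  using ov.dx_cong[OF L_eq p] dx_compose[OF tgt.sm_L p] by simp

lemma dy_dy_L:
  assumes p: "p \<in> W"
  shows "dy i (dy l src.L) p =
    (\<Sum>q\<in>UNIV. J q l (fst p) * (\<Sum>r\<in>UNIV. J r i (fst p) * dy r (dy q L') (\<Phi> p)))"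
proof -
  have "dy i (dy l src.L) p = dy i (\<lambda>p. \<Sum>q\<in>UNIV. J q l (fst p) * dy q L' (\<Phi> p)) p"
    by (rule ov.dy_cong[OF dy_L p])
  also have "\<dots> = (\<Sum>q\<in>UNIV. J q l (fst p) * dy i (\<lambda>p. dy q L' (\<Phi> p)) p)"
    by (intro dy_sum_J_mult fst_W p diff_compose) simp
  finally show ?thesis
    using p by (simp add: dy_compose)
qed

lemma dx_dy_L:
  assumes p: "p \<in> W"
  shows "dx k (dy l src.L) p =
    (\<Sum>q\<in>UNIV. J q l (fst p) * (\<Sum>r\<in>UNIV. J r k (fst p) * dx r (dy q L') (\<Phi> p)))
    + (\<Sum>q\<in>UNIV. J q l (fst p) * (\<Sum>r\<in>UNIV. N r k p * dy r (dy q L') (\<Phi> p)))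
    + (\<Sum>q\<in>UNIV. H q l k (fst p) * dy q L' (\<Phi> p))"
proof -
  have "dx k (dy l src.L) p = dx k (\<lambda>p. \<Sum>q\<in>UNIV. J q l (fst p) * dy q L' (\<Phi> p)) p"
    by (rule ov.dx_cong[OF dy_L p])
  also have "\<dots> = (\<Sum>q\<in>UNIV. J q l (fst p) * dx k (\<lambda>p. dy q L' (\<Phi> p)) p
      + H q l k (fst p) * dy q L' (\<Phi> p))"
    by (intro dx_sum_J_mult fst_W p diff_compose) simp
  finally show ?thesis
    using p by (simp add: dx_compose sum.distrib distrib_left)
qed

text \<open>The second derivative of \<open>\<phi>\<close> evaluated at (y, y).\<close>

definition N0 :: "'n \<Rightarrow> 'n tpoint \<Rightarrow> real" where
  "N0 r p = (\<Sum>k\<in>UNIV. N r k p * snd p $ k)"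

text \<open>Both sides solve the linear system that characterises the spray coefficients in the target
  chart.\<close>

lemma spray_coeff_transform:
  assumes p: "p \<in> W"
  shows "(\<Sum>i\<in>UNIV. J r i (fst p) * src.G i p) = tgt.G r (\<Phi> p) + 1/2 * N0 r p"
proof -
  let ?x = "fst p"
  let ?T = "\<lambda>r q. dy r (dy q L') (\<Phi> p)"
  let ?g = "\<lambda>r. \<Sum>i\<in>UNIV. J r i ?x * src.G i p"
  have "(\<Sum>q\<in>UNIV. J q l ?x * (2 * (\<Sum>r\<in>UNIV. ?T r q * ?g r))) =
      (\<Sum>q\<in>UNIV. J q l ?x * (2 * (\<Sum>i\<in>UNIV. ?T i q * tgt.G i (\<Phi> p)) + (\<Sum>r\<in>UNIV. ?T r q * N0 r p)))" for l
  proof -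
    have "(\<Sum>q\<in>UNIV. J q l ?x * (2 * (\<Sum>r\<in>UNIV. ?T r q * ?g r))) =
        2 * (\<Sum>i\<in>UNIV. dy i (dy l src.L) p * src.G i p)"
      unfolding dy_dy_L[OF p] sum_triple_rotate by (simp add: sum_distrib_left mult.left_commute)
    also have "\<dots> = (\<Sum>k\<in>UNIV. dx k (dy l src.L) p * snd p $ k) - dx l src.L p"
      using src.spray_equation[OF subsetD[OF W_subset p], of l] by (simp add: mult.commute)
    also have "(\<Sum>k\<in>UNIV. dx k (dy l src.L) p * snd p $ k) =
        (\<Sum>q\<in>UNIV. J q l ?x * (\<Sum>r\<in>UNIV. dx r (dy q L') (\<Phi> p) * snd (\<Phi> p) $ r))
        + (\<Sum>q\<in>UNIV. J q l ?x * (\<Sum>r\<in>UNIV. ?T r q * N0 r p))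
        + (\<Sum>k\<in>UNIV. (\<Sum>q\<in>UNIV. H q l k ?x * dy q L' (\<Phi> p)) * snd p $ k)"
      unfolding dx_dy_L[OF p] distrib_right sum.distrib sum_triple_rotate snd_\<Phi> N0_def ..
    \<comment> \<open>By symmetry of the Hessian this sum is exactly the extra term in
      \<open>dx_L\<close> and cancels against it.\<close>
    also have "(\<Sum>k\<in>UNIV. (\<Sum>q\<in>UNIV. H q l k ?x * dy q L' (\<Phi> p)) * snd p $ k) =
        (\<Sum>q\<in>UNIV. N q l p * dy q L' (\<Phi> p))"
      unfolding N_def sum_distrib_left sum_distrib_right H_commute[OF fst_W[OF p], of _ l]
      by (subst sum.swap) (simp add: ac_simps)
    finally show ?thesis
      unfolding dx_L[OF p] tgt.spray_equation[OF \<Phi>_in[OF p]]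
      by (simp add: sum.distrib sum_subtractf right_diff_distrib distrib_left mult.commute[of "dx _ _ _"])
  qed
  note cancel = J_cancel[OF fst_W[OF p] this]
  have "(\<Sum>r\<in>UNIV. ?T r q * ?g r) = (\<Sum>r\<in>UNIV. ?T r q * (tgt.G r (\<Phi> p) + 1/2 * N0 r p))" for q
    using cancel[of q] by (simp add: distrib_left sum.distrib sum_divide_distrib[symmetric])
  from tgt.spray_unique[OF \<Phi>_in[OF p] this] show ?thesis
    by (rule fun_cong)
qed

lemma sm_J [simp]: "ov.sm (\<lambda>p. J q j (fst p))"
  by (intro smooth_on_compose_fst open_X open_Compl closed_singleton smooth_J)

lemma sm_H [simp]: "ov.sm (\<lambda>p. H q j l (fst p))"
  by (intro smooth_on_compose_fst open_X open_Compl closed_singleton smooth_H)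

lemma dy_fst [simp]:
  fixes h :: "real ^ 'n \<Rightarrow> real"
  assumes "smooth_on X h" "p \<in> W"
  shows "dy l (\<lambda>p. h (fst p)) p = 0"
  using frechet_derivative_compose_fst(2)[OF smooth_on_differentiable[OF assms(1) fst_W[OF assms(2)]]]
    linear_0[OF linear_frechet_derivative[OF smooth_on_differentiable[OF assms(1) fst_W[OF assms(2)]]]]
  by (simp add: dy_def)

lemma sm_src: "src.sm h \<Longrightarrow> ov.sm h"
  using smooth_on_subset[OF _ W_subset] .

lemma sm_N0 [simp]: "ov.sm (N0 r)"
  by (simp add: N0_def[abs_def] N_def)

text \<open>The inhomogeneous term of the transformation law is quadratic in \<open>y\<close>, so that it does not
  contribute to the third derivatives.\<close>

lemma dy_dy_dy_N0:
  assumes p: "p \<in> W"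
  shows "dy j (dy k (dy l (N0 r))) p = 0"
proof -
  have 1: "dy l (N0 r) p = (\<Sum>i\<in>UNIV. H r i l (fst p) * snd p $ i) + (\<Sum>i\<in>UNIV. H r l i (fst p) * snd p $ i)"
    if "p \<in> W" for p
    using that unfolding N0_def[abs_def] N_def
    by (simp add: ov.dy_rules smooth_H sum.distrib)
  have 2: "dy k (dy l (N0 r)) p = H r k l (fst p) + H r l k (fst p)" if "p \<in> W" for p
    by (rule trans[OF ov.dy_cong[OF 1 that]], assumption)
      (use that in \<open>simp add: ov.dy_rules smooth_H sum.distrib\<close>)
  show ?thesis
    by (rule trans[OF ov.dy_cong[OF 2 p]], assumption)
      (use p in \<open>simp add: ov.dy_rules smooth_H\<close>)
qed

text \<open>Three y-derivatives of the law for the spray coefficients: the Jacobians depend on x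
  alone and the quadratic term drops out.\<close>

lemma berwald_curv_transform:
  assumes p: "p \<in> W"
  shows "(\<Sum>i\<in>UNIV. J r i (fst p) * src.B j i k l p) =
    (\<Sum>q\<in>UNIV. J q j (fst p) * (\<Sum>s\<in>UNIV. J s k (fst p) * (\<Sum>t\<in>UNIV. J t l (fst p) * tgt.B q r s t (\<Phi> p))))"
proof -
  have sm_G: "ov.sm (src.G i)" for i
    by (rule sm_src) simp
  \<comment> \<open>On the overlap \<open>?E\<close> is the pullback of the target spray
    coefficient. It is differentiated both in source coordinates (\<open>L1\<close> to
    \<open>L3\<close>) and by the chain rule (\<open>R1\<close> to \<open>R3\<close>).\<close>
  let ?E = "\<lambda>p. (\<Sum>i\<in>UNIV. J r i (fst p) * src.G i p) - 1/2 * N0 r p"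
  have sm_E [simp]: "ov.sm ?E"
    by (intro ov.sm_intros sm_J sm_G sm_N0)
  have L1: "dy m ?E p = (\<Sum>i\<in>UNIV. J r i (fst p) * dy m (src.G i) p) - 1/2 * dy m (N0 r) p"
    if "p \<in> W" for p m
    using that sm_G by (simp add: ov.dy_rules smooth_J ov.dy_divide)
  have L2: "dy m (dy m' ?E) p = (\<Sum>i\<in>UNIV. J r i (fst p) * dy m (dy m' (src.G i)) p) - 1/2 * dy m (dy m' (N0 r)) p"
    if "p \<in> W" for p m m'
    by (rule trans[OF ov.dy_cong[OF L1 that]], assumption)
      (use that sm_G in \<open>simp add: ov.dy_rules smooth_J ov.dy_divide\<close>)
  have L3: "dy j (dy k (dy l ?E)) p = (\<Sum>i\<in>UNIV. J r i (fst p) * src.B j i k l p)"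
    by (rule trans[OF ov.dy_cong[OF L2 p]], assumption)
      (use p sm_G in \<open>simp add: ov.dy_rules smooth_J ov.dy_divide dy_dy_dy_N0 berwald_curv_def\<close>)
  have E: "?E p = tgt.G r (\<Phi> p)" if "p \<in> W" for p
    using spray_coeff_transform[OF that, of r] by simp
  have R1: "dy m ?E p = (\<Sum>t\<in>UNIV. J t m (fst p) * dy t (tgt.G r) (\<Phi> p))" if "p \<in> W" for p m
    using ov.dy_cong[OF E that] dy_compose[OF tgt.sm_G that] by simp
  have R2: "dy m (dy m' ?E) p = (\<Sum>t\<in>UNIV. J t m' (fst p) * (\<Sum>s\<in>UNIV. J s m (fst p) * dy s (dy t (tgt.G r)) (\<Phi> p)))"
    if p: "p \<in> W" for p m m'
  proof -
    have "dy m (dy m' ?E) p = dy m (\<lambda>p. \<Sum>t\<in>UNIV. J t m' (fst p) * dy t (tgt.G r) (\<Phi> p)) p"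
      by (rule ov.dy_cong[OF R1 p])
    also have "\<dots> = (\<Sum>t\<in>UNIV. J t m' (fst p) * dy m (\<lambda>p. dy t (tgt.G r) (\<Phi> p)) p)"
      by (intro dy_sum_J_mult fst_W p diff_compose) simp
    finally show ?thesis using p by (simp add: dy_compose)
  qed
  have R3: "dy l (dy k (dy j ?E)) p = (\<Sum>q\<in>UNIV. J q j (fst p) * (\<Sum>s\<in>UNIV. J s k (fst p)
      * (\<Sum>t\<in>UNIV. J t l (fst p) * dy t (dy s (dy q (tgt.G r))) (\<Phi> p))))"
  proof -
    have d: "(\<lambda>p. \<Sum>s\<in>UNIV. J s k (fst p) * dy s (dy q (tgt.G r)) (\<Phi> p)) differentiable (at p)" for q
      using smooth_on_differentiable[OF sm_J p] p
      by (intro differentiable_sum ballI differentiable_mult diff_compose) simp_all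
    have "dy l (dy k (dy j ?E)) p = dy l (\<lambda>p. \<Sum>q\<in>UNIV. J q j (fst p)
        * (\<Sum>s\<in>UNIV. J s k (fst p) * dy s (dy q (tgt.G r)) (\<Phi> p))) p"
      by (rule ov.dy_cong[OF R2 p])
    also have "\<dots> = (\<Sum>q\<in>UNIV. J q j (fst p)
        * dy l (\<lambda>p. \<Sum>s\<in>UNIV. J s k (fst p) * dy s (dy q (tgt.G r)) (\<Phi> p)) p)"
      by (intro dy_sum_J_mult fst_W p d)
    also have "\<dots> = (\<Sum>q\<in>UNIV. J q j (fst p)
        * (\<Sum>s\<in>UNIV. J s k (fst p) * dy l (\<lambda>p. dy s (dy q (tgt.G r)) (\<Phi> p)) p))"
      by (intro sum.cong refl arg_cong[where f = "\<lambda>x. _ * x"] dy_sum_J_mult fst_W p diff_compose) simp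
    finally show ?thesis using p by (simp add: dy_compose)
  qed
  \<comment> \<open>The chain rule leaves the index differentiated first in the outermost sum, so
    the order of derivatives has to be reversed on both sides.\<close>
  have perm: "dy a (dy b (dy c h)) z = dy c (dy b (dy a h)) z"
    if D: "tangent_open D" and h: "smooth_on D h" and z: "z \<in> D" for D and h :: "'n tpoint \<Rightarrow> real" and z a b c
  proof -
    interpret tangent_open D by (rule D)
    have "dy a (dy b (dy c h)) z = dy b (dy a (dy c h)) z"
      using h z by (intro dy_dy) simp_all
    also have "\<dots> = dy b (dy c (dy a h)) z"
      by (rule dy_cong[OF dy_dy[OF h] z])
    also have "\<dots> = dy c (dy b (dy a h)) z"
      using h z by (intro dy_dy) simp_all
    finally show ?thesis .
  qed
  have "dy l (dy k (dy j ?E)) p = dy j (dy k (dy l ?E)) p"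
    by (rule perm[OF ov.tangent_open_axioms sm_E p])
  moreover have "dy t (dy s (dy q (tgt.G r))) (\<Phi> p) = tgt.B q r s t (\<Phi> p)" for q s t
    unfolding berwald_curv_def by (rule perm[OF tgt.tangent_open_axioms tgt.sm_G \<Phi>_in[OF p]])
  ultimately show ?thesis
    unfolding L3 R3 by simp
qed

text \<open>F^2 is a scalar, and the Jacobian of its y-derivative absorbs the upper index of the
  Berwald curvature.\<close>

lemma berwald_radial_transform:
  assumes p: "p \<in> W"
  shows "berwald_radial f j k l p = (\<Sum>q\<in>UNIV. \<Sum>r\<in>UNIV. \<Sum>s\<in>UNIV.
     J q j (fst p) * J r k (fst p) * J s l (fst p) * berwald_radial f' q r s (\<Phi> p))"
proof -
  let ?c = "\<lambda>q r s. J q j (fst p) * J r k (fst p) * J s l (fst p)"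
  have "(\<Sum>i\<in>UNIV. dy i src.L p * src.B j i k l p) =
      (\<Sum>m\<in>UNIV. dy m L' (\<Phi> p) * (\<Sum>i\<in>UNIV. J m i (fst p) * src.B j i k l p))"
    unfolding dy_L[OF p] sum_distrib_left sum_distrib_right by (subst sum.swap) (simp add: ac_simps)
  also have "\<dots> = (\<Sum>m\<in>UNIV. \<Sum>q\<in>UNIV. \<Sum>r\<in>UNIV. \<Sum>s\<in>UNIV. ?c q r s * (dy m L' (\<Phi> p) * tgt.B q m r s (\<Phi> p)))"
    unfolding berwald_curv_transform[OF p] by (simp add: sum_distrib_left ac_simps)
  also have "\<dots> = (\<Sum>q\<in>UNIV. \<Sum>r\<in>UNIV. \<Sum>s\<in>UNIV. ?c q r s * (\<Sum>m\<in>UNIV. dy m L' (\<Phi> p) * tgt.B q m r s (\<Phi> p)))"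
    unfolding sum_distrib_left
    by (subst sum.swap, rule sum.cong[OF refl], subst sum.swap, rule sum.cong[OF refl], rule sum.swap)
  finally show ?thesis
    unfolding berwald_radial_def L_eq[OF p]
    by (simp only: times_divide_eq_right sum_divide_distrib[symmetric])
qed

lemma berwald_angular_transform:
  assumes p: "p \<in> W"
  shows "berwald_angular f j i k l p = (\<Sum>m\<in>UNIV. \<Sum>q\<in>UNIV. \<Sum>r\<in>UNIV. \<Sum>s\<in>UNIV.
     J' i m (fst p) * J q j (fst p) * J r k (fst p) * J s l (fst p) * berwald_angular f' q m r s (\<Phi> p))"
proof -
  let ?x = "fst p"
  have B: "src.B j i k l p = (\<Sum>m\<in>UNIV. \<Sum>q\<in>UNIV. \<Sum>r\<in>UNIV. \<Sum>s\<in>UNIV.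
     J' i m ?x * J q j ?x * J r k ?x * J s l ?x * tgt.B q m r s (\<Phi> p))"
    using J'_contract[OF fst_W[OF p], of i "\<lambda>i. src.B j i k l p"]
    unfolding berwald_curv_transform[OF p] by (simp add: sum_distrib_left mult.assoc)
  have y: "snd p $ i = (\<Sum>m\<in>UNIV. J' i m ?x * snd (\<Phi> p) $ m)"
    using J'_contract[OF fst_W[OF p], of i "\<lambda>j. snd p $ j"] by (simp add: snd_\<Phi>)
  have "berwald_radial f j k l p * snd p $ i =
      (\<Sum>m\<in>UNIV. (J' i m ?x * snd (\<Phi> p) $ m) * berwald_radial f j k l p)"
    unfolding y sum_distrib_left by (simp add: ac_simps)
  also have "\<dots> = (\<Sum>m\<in>UNIV. \<Sum>q\<in>UNIV. \<Sum>r\<in>UNIV. \<Sum>s\<in>UNIV.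
     J' i m ?x * J q j ?x * J r k ?x * J s l ?x * (berwald_radial f' q r s (\<Phi> p) * snd (\<Phi> p) $ m))"
    unfolding berwald_radial_transform[OF p] by (simp add: sum_distrib_left ac_simps)
  finally show ?thesis
    unfolding berwald_angular_def B by (simp add: right_diff_distrib sum_subtractf)
qed

end

section \<open>Finsler metrics on manifolds\<close>

lemma open_overlap:
  assumes "is_chart c" "is_chart d"
  shows "open (overlap c d)"
proof -
  obtain \<psi> where \<psi>: "homeomorphism (fst c) (snd c ` fst c) (snd c) \<psi>"
    using assms unfolding is_chart_def by blast
  have "openin (top_of_set (fst c)) (fst c \<inter> fst d)"
    using assms unfolding is_chart_def by (auto intro: openin_open_Int)
  from homeomorphism_imp_open_map[OF \<psi> this] show ?thesis
    using assms unfolding is_chart_def overlap_def by (metis openin_open_eq)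
qed

lemma transition_snd:
  assumes "is_chart c" "m \<in> fst c"
  shows "transition c d (snd c m) = snd d m"
proof -
  have "inj_on (snd c) (fst c)"
    using assms unfolding is_chart_def homeomorphism_def by (metis inj_on_inverseI)
  with assms(2) show ?thesis by (simp add: transition_def)
qed

lemma transition_overlap:
  assumes "is_chart c" "is_chart d" "x \<in> overlap c d"
  shows "transition c d x \<in> overlap d c" "transition d c (transition c d x) = x"
  using assms by (auto simp: overlap_def transition_snd)

text \<open>Chain rule for the two transitions, whose composition is the identity on a neighbourhood
  of \<open>x\<close>.\<close>

lemma jac_inverse:
  assumes A: "smooth_atlas A" "c \<in> A" "d \<in> A" and x: "x \<in> overlap c d"
  shows "(\<Sum>q\<in>UNIV. jac d c i q (transition c d x) * jac c d q j x) = (if i = j then 1 else 0)"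
proof -
  have ch: "is_chart c" "is_chart d" and sm: "smooth_on (overlap c d) (transition c d)"
    "smooth_on (overlap d c) (transition d c)"
    using A unfolding smooth_atlas_def by blast+
  let ?\<phi> = "transition c d" and ?\<psi> = "transition d c"
  interpret \<psi>: chart_change "overlap d c" ?\<psi>
    by (rule chart_change.intro[OF open_overlap[OF ch(2,1)] sm(2)])
  have d\<phi>: "(?\<phi> has_derivative (\<lambda>v. frechet_derivative ?\<phi> (at x) v)) (at x)"
    by (intro has_derivative_frechet_derivative smooth_on_differentiable[OF sm(1) x])
  have d\<psi>: "?\<psi> differentiable (at (?\<phi> x))"
    using transition_overlap(1)[OF ch x] by (rule smooth_on_differentiable[OF sm(2)])
  have "((\<lambda>x. ?\<psi> (?\<phi> x)) has_derivative
      (\<lambda>v. frechet_derivative ?\<psi> (at (?\<phi> x)) (frechet_derivative ?\<phi> (at x) v))) (at x)"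
    by (rule has_derivative_compose[OF d\<phi> has_derivative_frechet_derivative[OF d\<psi>]])
  moreover have "((\<lambda>x. ?\<psi> (?\<phi> x)) has_derivative (\<lambda>v. v)) (at x)"
    by (rule has_derivative_transform_within_open[OF has_derivative_ident open_overlap[OF ch] x])
      (simp add: transition_overlap(2)[OF ch])
  ultimately have "(\<lambda>v. frechet_derivative ?\<psi> (at (?\<phi> x)) (frechet_derivative ?\<phi> (at x) v)) = (\<lambda>v. v)"
    by (rule has_derivative_unique)
  then have "frechet_derivative ?\<psi> (at (?\<phi> x)) (frechet_derivative ?\<phi> (at x) (axis j 1)) = axis j 1"
    by (rule fun_cong)
  then have "frechet_derivative ?\<psi> (at (?\<phi> x)) (frechet_derivative ?\<phi> (at x) (axis j 1)) $ i = (if i = j then 1 else 0)"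
    by (simp add: axis_def)
  with \<psi>.frechet_derivative_\<phi>[OF transition_overlap(1)[OF ch x]] show ?thesis
    unfolding jac_def \<psi>.J_def[symmetric] by (rule trans[OF sym])
qed

lemma finsler_chartI:
  assumes "smooth_atlas A" "finsler_metric A F" "c \<in> A"
  shows "finsler_chart (snd c ` fst c) (F c)"
proof -
  have "open (snd c ` fst c)"
    using assms unfolding smooth_atlas_def is_chart_def by blast
  moreover have "smooth_on (slit_domain c) (F c)"
    and "\<forall>(x, y)\<in>tangent_domain c. \<forall>a>0. F c (x, a *\<^sub>R y) = a * F c (x, y)"
    and "\<forall>p\<in>slit_domain c. \<forall>v. v \<noteq> 0 \<longrightarrow> v \<bullet> (fund_tensor (F c) p *v v) > 0"
    using assms unfolding finsler_metric_def by blast+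
  ultimately show ?thesis
    unfolding slit_domain_def tangent_domain_def by (intro finsler_chart.intro) blast+
qed

lemma finsler_changeI:
  assumes A: "smooth_atlas A" and F: "finsler_metric A F" and cd: "c \<in> A" "d \<in> A"
  shows "finsler_change (overlap c d) (transition c d) (snd c ` fst c) (F c) (snd d ` fst d) (F d)
     (\<lambda>i p x. jac d c i p (transition c d x))"
    and "\<And>q j x. chart_change.J (transition c d) q j x = jac c d q j x"
    and "\<And>p. fst p \<in> overlap c d \<Longrightarrow> chart_change.\<Phi> (transition c d) p = tangent_transition c d p"
proof -
  have ch: "is_chart c" "is_chart d" and sm: "smooth_on (overlap c d) (transition c d)"
    using A cd unfolding smooth_atlas_def by blast+
  interpret chart_change "overlap c d" "transition c d"
    by (rule chart_change.intro[OF open_overlap[OF ch] sm])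
  show J: "J q j x = jac c d q j x" for q j x
    by (simp add: J_def jac_def)
  show \<Phi>: "\<Phi> p = tangent_transition c d p" if "fst p \<in> overlap c d" for p
    using frechet_derivative_\<phi>[OF that] snd_\<Phi>[of p]
    by (simp add: prod_eq_iff vec_eq_iff tangent_transition_def) (simp add: \<Phi>_def)
  interpret src: finsler_chart "snd c ` fst c" "F c" by (rule finsler_chartI[OF A F cd(1)])
  interpret tgt: finsler_chart "snd d ` fst d" "F d" by (rule finsler_chartI[OF A F cd(2)])
  show "finsler_change (overlap c d) (transition c d) (snd c ` fst c) (F c) (snd d ` fst d) (F d)
     (\<lambda>i p x. jac d c i p (transition c d x))"
  proof unfold_locales
    show "overlap c d \<subseteq> snd c ` fst c" by (auto simp: overlap_def)
    show "transition c d ` overlap c d \<subseteq> snd d ` fst d"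
      using transition_overlap(1)[OF ch] by (auto simp: overlap_def)
    show "F c p = F d (\<Phi> p)" if "fst p \<in> overlap c d" for p
    proof -
      have "F c (fst p, snd p) = F d (tangent_transition c d (fst p, snd p))"
        using F cd that unfolding finsler_metric_def tangent_function_def by blast
      then show ?thesis by (simp add: \<Phi>[OF that])
    qed
    fix x q s assume x: "x \<in> overlap c d"
    show "(\<Sum>l\<in>UNIV. jac d c q l (transition c d x) * J l s x) = (if q = s then 1 else 0)"
      using jac_inverse[OF A cd x] by (simp add: J)
    \<comment> \<open>The same inverse relation with the charts exchanged, taken at the image point,
      whose image under the reverse transition is \<open>x\<close>.\<close>
    show "(\<Sum>l\<in>UNIV. J q l x * jac d c l s (transition c d x)) = (if q = s then 1 else 0)"
      using jac_inverse[OF A cd(2,1) transition_overlap(1)[OF ch x], of q s]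
      by (simp add: J transition_overlap(2)[OF ch x])
  qed
qed

theorem lemma3p1:
  fixes A :: "('m::{t2_space, second_countable_topology}, 'n::finite) chart set"
    and F :: "('m, 'n) chart \<Rightarrow> 'n tpoint \<Rightarrow> real"
  assumes "smooth_atlas A"
    and "CARD('n) > 2"
    and "finsler_metric A F"
    and "W_tilde_metric A F"
  shows "GBW_tilde_metric A F"
proof -
  \<comment> \<open>Both witnesses are given by one formula in \<open>F c\<close> for all charts,
    which is why the transformation laws can be proved.\<close>
  let ?b = "\<lambda>c. berwald_radial (F c)" and ?\<beta> = "\<lambda>c. berwald_angular (F c)"
  have chart: "finsler_chart (snd c ` fst c) (F c)" if "c \<in> A" for c
    using finsler_chartI[OF assms(1,3) that] .
  have smooth: "smooth_on (slit_domain c) (?b c j k l)" "smooth_on (slit_domain c) (?\<beta> c j i k l)"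
    if "c \<in> A" for c j i k l
    using finsler_chart.sm_radial[OF chart[OF that]] finsler_chart.sm_angular[OF chart[OF that]]
    by (simp_all add: slit_domain_def)
  have "tensor_0_3 A ?b"
    unfolding tensor_0_3_def
  proof (intro conjI ballI allI impI)
    fix c d x y j k l
    assume cd: "c \<in> A" "d \<in> A" and x: "x \<in> overlap c d" and y: "(y :: real ^ 'n) \<noteq> 0"
    note change = finsler_changeI[OF assms(1,3) cd]
    from x y show "?b c j k l (x, y) = (\<Sum>q\<in>UNIV. \<Sum>r\<in>UNIV. \<Sum>s\<in>UNIV.
             jac c d q j x * jac c d r k x * jac c d s l x * ?b d q r s (tangent_transition c d (x, y)))"
      using finsler_change.berwald_radial_transform[OF change(1), of "(x, y)"]
      by (simp add: change(2,3))
  qed (rule smooth)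
  moreover have "tensor_1_3 A ?\<beta>"
    unfolding tensor_1_3_def
  proof (intro conjI ballI allI impI)
    fix c d x y j i k l
    assume cd: "c \<in> A" "d \<in> A" and x: "x \<in> overlap c d" and y: "(y :: real ^ 'n) \<noteq> 0"
    note change = finsler_changeI[OF assms(1,3) cd]
    from x y show "?\<beta> c j i k l (x, y) = (\<Sum>p\<in>UNIV. \<Sum>q\<in>UNIV. \<Sum>r\<in>UNIV. \<Sum>s\<in>UNIV.
             jac d c i p (transition c d x) * jac c d q j x * jac c d r k x * jac c d s l x
             * ?\<beta> d q p r s (tangent_transition c d (x, y)))"
      using finsler_change.berwald_angular_transform[OF change(1), of "(x, y)"]
      by (simp add: change(2,3))
  qed (rule smooth)
  moreover have "berwald_curv (F c) j i k l p = ?\<beta> c j i k l p + ?b c j k l p * snd p $ i" for c j i k l p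
    by (simp add: berwald_angular_def)
  moreover have "(\<Sum>m\<in>UNIV. hcov_1_3 (F c) (?\<beta> c) j i k l m p * snd p $ m) = 0"
    if c: "c \<in> A" and p: "p \<in> slit_domain c" for c j i k l p
  proof -
    interpret finsler_chart "snd c ` fst c" "F c" by (rule chart[OF c])
    have W: "\<And>p i k. p \<in> U \<Longrightarrow> W_tilde (F c) i k p = 0"
      using assms(4) c unfolding W_tilde_metric_def slit_domain_def by blast
    obtain e where
      "\<And>p j i k l. p \<in> U \<Longrightarrow> (\<Sum>m\<in>UNIV. hcov_1_3 (F c) B j i k l m p * snd p $ m) = e j k l p * snd p $ i"
      using W_tilde_zero_imp_berwald[OF W] assms(2) by auto
    with p show ?thesis
      by (intro angular_spray_derivative[of p "\<lambda>j k l. e j k l p"]) (simp_all add: slit_domain_def)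
  qed
  ultimately show ?thesis
    unfolding GBW_tilde_metric_def by blast
qed

end
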